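(* (A) Suppose $u=u(x,t)$, $s=s(t)>0$ is a solution to the free boundary problem $$u_t=u^2(Du_{xx}-u_x),\quad 0<x<s(t),\ t>0,$$ $$u(0,t)=f(t),\qquad u(s(t),t)=\beta,\qquad Du_x(s(t),t)-u(s(t),t)=-\dot s(t),\quad t>0,$$ $$u(x,0)=u_0(x),\ 0\le x\le b,\qquad s(0)=b.$$ Let $C_1$ be an arbitrary constant and define $v(z,t)=u(x,t)$, where $$z=z(x,t)=C_1+\int_0^t\big(u(0,\tau)-Du_x(0,\tau)\big)\,d\tau+\int_0^x\frac{1}{u(\eta,t)}\,d\eta ,$$ and $z_0(t)=z(0,t)$, $z_1(t)=z(s(t),t)$. Then $$z_0(t)=C_1+\int_0^t\Big(f(\tau)-D\frac{v_z(z_0(\tau),\tau)}{f(\tau)}\Big)d\tau,\qquad (\ast)$$ $$z_1(t)=C_2+(\beta+1)t-\frac{D(\beta+1)}{\beta^2}\int_0^t v_z(z_1(\tau),\tau)\,d\tau ,$$ and $v,z_0,z_1$ is a solution to the problem $$v_t=Dv_{zz}-2vv_z,\quad z_0(t)<z<z_1(t),\ t>0,$$ $$v(z_0(t),t)=f(t),\qquad v(z_1(t),t)=\beta,\quad t>0,$$ $$D\frac{v_z(z_1(t),t)}{v(z_1(t),t)}-v(z_1(t),t)=-\frac{\beta}{\beta+1}\dot z_1(t),\quad t>0,$$ $$v(z,0)=v_0(z),\ C_1\le z\le C_2,\qquad z_0(0)=C_1,\quad z_1(0)=C_2,$$ where $v_0(z)=u_0(g^{-1}(z))$, $g(x)=C_1+\int_0^x\frac{1}{u_0(\eta)}d\eta$,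 $C_2=C_1+U_0=C_1+\int_0^b\frac{1}{u_0(\eta)}d\eta$, and the constants $b,C_1,C_2$ satisfy $b=\int_{C_1}^{C_2}v_0(z)\,dz$. (B) Conversely, if $v=v(z,t)$, $z_0(t)$, $z_1(t)$ is a solution to the problem for the Burgers equation $$v_t=Dv_{zz}-2vv_z,\quad z_0(t)<z<z_1(t),\ t>0,$$ $$v(z_0(t),t)=f(t),\qquad v(z_1(t),t)=\beta,\quad t>0,$$ $$D\frac{v_z(z_1(t),t)}{v(z_1(t),t)}-v(z_1(t),t)=-\frac{\beta}{\beta+1}\dot z_1(t),\quad t>0,$$ $$v(z,0)=v_0(z),\ C_1\le z\le C_2,\qquad z_0(0)=C_1,\quad z_1(0)=C_2,$$ where $C_1$ is an arbitrary constant, $C_2=C_1+\int_0^b\frac{1}{u_0(\eta)}d\eta$, $v_0(z)=u_0(g^{-1}(z))$ with $g(x)=C_1+\int_0^x\frac{1}{u_0(\eta)}d\eta$, and with $z_0$ given by $z_0(t)=C_1+\int_0^t\big(f(\tau)-D\frac{v_z(z_0(\tau),\tau)}{f(\tau)}\big)d\tau$, then $u=u(x,t)$, $s=s(t)$ given by $$u(x,t)=v(z,t),\qquad x=x(z,t)=\int_{z_0(t)}^{z}v(\eta,t)\,d\eta,\qquad s(t)=x(z_1(t),t)=\int_{z_0(t)}^{z_1(t)}v(\eta,t)\,d\eta$$ is a solution to the free boundary problem $$u_t=u^2(Du_{xx}-u_x),\quad 0<x<s(t),\ t>0,$$ $$u(0,t)=f(t),\qquad u(s(t),t)=\beta,\qquad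 Du_x(s(t),t)-u(s(t),t)=-\dot s(t),\quad t>0,$$ $$u(x,0)=u_0(x),\ 0\le x\le b,\qquad s(0)=b.$$
   Context: $D>0$ (diffusivity), $\beta>0$, $b>0$ and $\sigma>0$ are constants. The data satisfy: $f\in C^1[0,\sigma]$, $u_0\in C^1[0,b]$, $u_0(0)=f(0)$, $u_0(b)=\beta$, $u_0(x)>\beta$ for $0\le x<b$, and $f(t)>\frac{3\beta}{2}$. Solutions are understood in the classical sense; conditions "for $t>0$" are understood on the time interval where $f$ is given. A dot denotes differentiation in $t$. *)

theory Defs
  imports "HOL-Analysis.Analysis"
begin

text \<open>
  A function of the class \<open>C\<^sup>1[a,b]\<close>; the derivatives at the end points are one-sided, so that
  values outside the interval play no role.
\<close>

definition C1_on_interval :: "real \<Rightarrow> real \<Rightarrow> (real \<Rightarrow> real) \<Rightarrow> bool" where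
  "C1_on_interval a b h \<longleftrightarrow>
     (\<exists>h'. (\<forall>x\<in>{a..b}. (h has_real_derivative h' x) (at x within {a..b})) \<and>
           continuous_on {a..b} h')"

text \<open>
  A function \<open>w(y,t)\<close> on the moving region \<open>lo(t) \<le> y \<le> hi(t)\<close>, \<open>0 \<le> t \<le> T\<close>, is represented by a
  total function whose values elsewhere are irrelevant. Hence derivatives are taken within the
  region: they are one-sided on the lateral boundary and at the final time \<open>T\<close>, and two-sided
  elsewhere for \<open>t > 0\<close>.
\<close>

definition space_deriv ::
  "(real \<Rightarrow> real) \<Rightarrow> (real \<Rightarrow> real) \<Rightarrow> (real \<Rightarrow> real \<Rightarrow> real) \<Rightarrow> real \<Rightarrow> real \<Rightarrow> real" where
  "space_deriv lo hi w y t = vector_derivative (\<lambda>\<eta>. w \<eta> t) (at y within {lo t..hi t})"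

definition time_deriv :: "real \<Rightarrow> (real \<Rightarrow> real) \<Rightarrow> real \<Rightarrow> real" where
  "time_deriv T h t = vector_derivative h (at t within {0..T})"

definition closed_region :: "(real \<Rightarrow> real) \<Rightarrow> (real \<Rightarrow> real) \<Rightarrow> real \<Rightarrow> (real \<times> real) set" where
  "closed_region lo hi T = {(y, t). 0 \<le> t \<and> t \<le> T \<and> lo t \<le> y \<and> y \<le> hi t}"

definition lateral_region :: "(real \<Rightarrow> real) \<Rightarrow> (real \<Rightarrow> real) \<Rightarrow> real \<Rightarrow> (real \<times> real) set" where
  "lateral_region lo hi T = {(y, t). 0 < t \<and> t \<le> T \<and> lo t \<le> y \<and> y \<le> hi t}"

definition inner_region :: "(real \<Rightarrow> real) \<Rightarrow> (real \<Rightarrow> real) \<Rightarrow> real \<Rightarrow> (real \<times> real) set" where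
  "inner_region lo hi T = {(y, t). 0 < t \<and> t \<le> T \<and> lo t < y \<and> y < hi t}"

text \<open>
  Regularity of a classical solution in the sense customary for Stefan problems: \<open>w\<close> is
  continuous up to the whole boundary, \<open>w\<^sub>y\<close> is continuous up to the lateral boundary for \<open>t > 0\<close>,
  and \<open>w\<^sub>y\<^sub>y\<close>, \<open>w\<^sub>t\<close> are continuous inside.
\<close>

definition classical ::
  "(real \<Rightarrow> real) \<Rightarrow> (real \<Rightarrow> real) \<Rightarrow> real \<Rightarrow> (real \<Rightarrow> real \<Rightarrow> real) \<Rightarrow> bool" where
  "classical lo hi T w \<longleftrightarrow>
     continuous_on (closed_region lo hi T) (\<lambda>(y, t). w y t) \<and>
     (\<forall>(y, t)\<in>lateral_region lo hi T.
        (\<lambda>\<eta>. w \<eta> t) differentiable (at y within {lo t..hi t})) \<and>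
     continuous_on (lateral_region lo hi T) (\<lambda>(y, t). space_deriv lo hi w y t) \<and>
     (\<forall>(y, t)\<in>inner_region lo hi T.
        (\<lambda>\<eta>. space_deriv lo hi w \<eta> t) differentiable (at y within {lo t..hi t}) \<and>
        (\<lambda>\<tau>. w y \<tau>) differentiable (at t within {0..T})) \<and>
     continuous_on (inner_region lo hi T)
       (\<lambda>(y, t). space_deriv lo hi (space_deriv lo hi w) y t) \<and>
     continuous_on (inner_region lo hi T) (\<lambda>(y, t). time_deriv T (w y) t)"

definition free_boundary :: "real \<Rightarrow> (real \<Rightarrow> real) \<Rightarrow> bool" where
  "free_boundary T r \<longleftrightarrow>
     continuous_on {0..T} r \<and>
     (\<forall>t\<in>{0<..T}. r differentiable (at t within {0..T})) \<and>
     continuous_on {0<..T} (time_deriv T r)"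

definition fbp_solution ::
  "real \<Rightarrow> real \<Rightarrow> real \<Rightarrow> real \<Rightarrow> (real \<Rightarrow> real) \<Rightarrow> (real \<Rightarrow> real) \<Rightarrow>
   (real \<Rightarrow> real \<Rightarrow> real) \<Rightarrow> (real \<Rightarrow> real) \<Rightarrow> bool" where
  "fbp_solution D \<beta> b \<sigma> f u\<^sub>0 u s \<longleftrightarrow>
     (let u\<^sub>x = space_deriv (\<lambda>_. 0) s u; u\<^sub>x\<^sub>x = space_deriv (\<lambda>_. 0) s u\<^sub>x in
       free_boundary \<sigma> s \<and>
       (\<forall>t\<in>{0..\<sigma>}. 0 < s t) \<and>
       classical (\<lambda>_. 0) s \<sigma> u \<and>
       (\<forall>t\<in>{0<..\<sigma>}. \<forall>x\<in>{0<..<s t}.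
          time_deriv \<sigma> (u x) t = (u x t)\<^sup>2 * (D * u\<^sub>x\<^sub>x x t - u\<^sub>x x t)) \<and>
       (\<forall>t\<in>{0<..\<sigma>}. u 0 t = f t \<and> u (s t) t = \<beta> \<and>
          D * u\<^sub>x (s t) t - u (s t) t = - time_deriv \<sigma> s t) \<and>
       (\<forall>x\<in>{0..b}. u x 0 = u\<^sub>0 x) \<and>
       s 0 = b)"

definition burgers_solution ::
  "real \<Rightarrow> real \<Rightarrow> real \<Rightarrow> (real \<Rightarrow> real) \<Rightarrow> real \<Rightarrow> real \<Rightarrow> (real \<Rightarrow> real) \<Rightarrow>
   (real \<Rightarrow> real \<Rightarrow> real) \<Rightarrow> (real \<Rightarrow> real) \<Rightarrow> (real \<Rightarrow> real) \<Rightarrow> bool" where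
  "burgers_solution D \<beta> \<sigma> f C\<^sub>1 C\<^sub>2 v\<^sub>0 v z\<^sub>0 z\<^sub>1 \<longleftrightarrow>
     (let v\<^sub>z = space_deriv z\<^sub>0 z\<^sub>1 v; v\<^sub>z\<^sub>z = space_deriv z\<^sub>0 z\<^sub>1 v\<^sub>z in
       continuous_on {0..\<sigma>} z\<^sub>0 \<and>
       free_boundary \<sigma> z\<^sub>1 \<and>
       (\<forall>t\<in>{0..\<sigma>}. z\<^sub>0 t < z\<^sub>1 t) \<and>
       classical z\<^sub>0 z\<^sub>1 \<sigma> v \<and>
       (\<forall>t\<in>{0<..\<sigma>}. \<forall>z\<in>{z\<^sub>0 t<..<z\<^sub>1 t}.
          time_deriv \<sigma> (v z) t = D * v\<^sub>z\<^sub>z z t - 2 * v z t * v\<^sub>z z t) \<and>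
       (\<forall>t\<in>{0<..\<sigma>}. v (z\<^sub>0 t) t = f t \<and> v (z\<^sub>1 t) t = \<beta> \<and>
          D * (v\<^sub>z (z\<^sub>1 t) t / v (z\<^sub>1 t) t) - v (z\<^sub>1 t) t = - (\<beta> / (\<beta> + 1)) * time_deriv \<sigma> z\<^sub>1 t) \<and>
       (\<forall>z\<in>{C\<^sub>1..C\<^sub>2}. v z 0 = v\<^sub>0 z) \<and>
       z\<^sub>0 0 = C\<^sub>1 \<and> z\<^sub>1 0 = C\<^sub>2)"

text \<open>
  In the next two definitions the integrands are continuous for \<open>0 < \<tau> \<le> \<sigma>\<close> but need not be bounded
  near \<open>\<tau> = 0\<close>, so the gauge integral is an improper Riemann integral there. Its existence is
  stated separately, as a divergent \<open>integral\<close> is \<open>0\<close> by convention.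
\<close>

definition left_boundary_eq ::
  "real \<Rightarrow> real \<Rightarrow> (real \<Rightarrow> real) \<Rightarrow> real \<Rightarrow>
   (real \<Rightarrow> real \<Rightarrow> real) \<Rightarrow> (real \<Rightarrow> real) \<Rightarrow> (real \<Rightarrow> real) \<Rightarrow> bool" where
  "left_boundary_eq D \<sigma> f C\<^sub>1 v z\<^sub>0 z\<^sub>1 \<longleftrightarrow>
     (\<forall>t\<in>{0..\<sigma>}.
        (\<lambda>\<tau>. f \<tau> - D * (space_deriv z\<^sub>0 z\<^sub>1 v (z\<^sub>0 \<tau>) \<tau> / f \<tau>)) integrable_on {0..t} \<and>
        z\<^sub>0 t = C\<^sub>1 + integral {0..t} (\<lambda>\<tau>. f \<tau> - D * (space_deriv z\<^sub>0 z\<^sub>1 v (z\<^sub>0 \<tau>) \<tau> / f \<tau>)))"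

definition right_boundary_eq ::
  "real \<Rightarrow> real \<Rightarrow> real \<Rightarrow> real \<Rightarrow>
   (real \<Rightarrow> real \<Rightarrow> real) \<Rightarrow> (real \<Rightarrow> real) \<Rightarrow> (real \<Rightarrow> real) \<Rightarrow> bool" where
  "right_boundary_eq D \<beta> \<sigma> C\<^sub>2 v z\<^sub>0 z\<^sub>1 \<longleftrightarrow>
     (\<forall>t\<in>{0..\<sigma>}.
        (\<lambda>\<tau>. space_deriv z\<^sub>0 z\<^sub>1 v (z\<^sub>1 \<tau>) \<tau>) integrable_on {0..t} \<and>
        z\<^sub>1 t = C\<^sub>2 + (\<beta> + 1) * t
               - D * (\<beta> + 1) / \<beta>\<^sup>2 * integral {0..t} (\<lambda>\<tau>. space_deriv z\<^sub>0 z\<^sub>1 v (z\<^sub>1 \<tau>) \<tau>))"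

definition initial_map :: "(real \<Rightarrow> real) \<Rightarrow> real \<Rightarrow> real \<Rightarrow> real" where
  "initial_map u\<^sub>0 C\<^sub>1 x = C\<^sub>1 + integral {0..x} (\<lambda>\<eta>. 1 / u\<^sub>0 \<eta>)"

definition burgers_initial :: "(real \<Rightarrow> real) \<Rightarrow> real \<Rightarrow> real \<Rightarrow> real \<Rightarrow> real" where
  "burgers_initial u\<^sub>0 b C\<^sub>1 z = u\<^sub>0 (inv_into {0..b} (initial_map u\<^sub>0 C\<^sub>1) z)"

definition to_z ::
  "real \<Rightarrow> (real \<Rightarrow> real \<Rightarrow> real) \<Rightarrow> (real \<Rightarrow> real) \<Rightarrow> real \<Rightarrow> real \<Rightarrow> real \<Rightarrow> real" where
  "to_z D u s C\<^sub>1 x t =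
     C\<^sub>1 + integral {0..t} (\<lambda>\<tau>. u 0 \<tau> - D * space_deriv (\<lambda>_. 0) s u 0 \<tau>)
        + integral {0..x} (\<lambda>\<eta>. 1 / u \<eta> t)"

definition to_x :: "(real \<Rightarrow> real \<Rightarrow> real) \<Rightarrow> (real \<Rightarrow> real) \<Rightarrow> real \<Rightarrow> real \<Rightarrow> real" where
  "to_x v z\<^sub>0 z t = integral {z\<^sub>0 t..z} (\<lambda>\<eta>. v \<eta> t)"

text \<open>
  \<open>change_var lo hi \<phi> w\<close> is the function \<open>W\<close> with \<open>W(\<phi>(y,t),t) = w(y,t)\<close> for \<open>lo(t) \<le> y \<le> hi(t)\<close>,
  provided that \<open>\<phi>(\<sqdot>,t)\<close> is injective there.
\<close>

definition change_var ::
  "(real \<Rightarrow> real) \<Rightarrow> (real \<Rightarrow> real) \<Rightarrow> (real \<Rightarrow> real \<Rightarrow> real) \<Rightarrow>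
   (real \<Rightarrow> real \<Rightarrow> real) \<Rightarrow> real \<Rightarrow> real \<Rightarrow> real" where
  "change_var lo hi \<phi> w p t = w (inv_into {lo t..hi t} (\<lambda>y. \<phi> y t) p) t"

end

theory Submission
  imports Defs
begin

text \<open>
  Both equations are conservation laws. The first one reads \<open>(1/u)\<^sub>t = (u - D u\<^sub>x)\<^sub>x\<close>, so that
  the 1-form \<open>(1/u) dx + (u - D u\<^sub>x) dt\<close> is closed, and \<open>z(x,t)\<close> is its potential. The
  Burgers equation reads \<open>v\<^sub>t = (D v\<^sub>z - v\<^sup>2)\<^sub>z\<close>, so that \<open>v dz + (D v\<^sub>z - v\<^sup>2) dt\<close> is closed; the
  equation for \<open>z\<^sub>0\<close> says that this form vanishes along the left boundary, hence \<open>x(z,t)\<close> is the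
  potential that is zero there. In either case the potential \<open>P\<close> of a closed form
  \<open>p dy + q dt\<close> with \<open>p > 0\<close> replaces the space variable \<open>y\<close>, and the transformed derivatives are
  \<open>w\<^sub>y / p\<close>, \<open>(w\<^sub>y / p)\<^sub>y / p\<close> and \<open>w\<^sub>t - w\<^sub>y q / p\<close>. Substituting \<open>p\<close> and \<open>q\<close> turns one equation
  into the other. Along a boundary curve \<open>r(t)\<close> the potential grows at the rate \<open>p r' + q\<close>; with the
  flux condition this gives \<open>z\<^sub>1' = (1 + 1/\<beta>) s'\<close> in both directions, which is what the conditions on
  the free boundaries and the integral equation for \<open>z\<^sub>1\<close> express.

  Three points need an argument beyond the chain rule. First, \<open>p > 0\<close>: solutions are at least
  \<open>\<beta>\<close> by the minimum principle (\<open>minimum_principle\<close>). Second, the second derivatives exist only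
  inside the region, so that differentiating \<open>P\<close> under an integral that starts on the boundary
  requires an approximation from inside (\<open>flux\<close>). Third, nothing is known about \<open>u\<^sub>x\<close> as
  \<open>t \<rightarrow> 0\<close>, so that even the integral of \<open>u\<^sub>x(0,t)\<close> in the definition of \<open>z\<close> has to be shown to
  exist; averaging the potential over a strip \<open>0 \<le> x \<le> a\<close> trades \<open>u\<^sub>x\<close> for boundary values of \<open>u\<close>
  (\<open>boundary_flux_primitive\<close>).
\<close>

section \<open>Derivatives of classical solutions\<close>

lemma has_real_derivative_space_deriv:
  assumes "(\<lambda>\<eta>. w \<eta> t) differentiable (at y within {lo t..hi t})"
  shows "((\<lambda>\<eta>. w \<eta> t) has_real_derivative space_deriv lo hi w y t) (at y within {lo t..hi t})"
  using assms unfolding space_deriv_def has_real_derivative_iff_has_vector_derivative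
  by (simp add: vector_derivative_works)

lemma space_deriv_eqI:
  assumes "((\<lambda>\<eta>. w \<eta> t) has_real_derivative d) (at y within {lo t..hi t})"
    and "lo t < hi t" "lo t \<le> y" "y \<le> hi t"
  shows "space_deriv lo hi w y t = d"
  using assms unfolding space_deriv_def has_real_derivative_iff_has_vector_derivative
  by (auto intro: vector_derivative_within_closed_interval)

lemma has_real_derivative_time_deriv:
  assumes "h differentiable (at t within {0..T})"
  shows "(h has_real_derivative time_deriv T h t) (at t within {0..T})"
  using assms unfolding time_deriv_def has_real_derivative_iff_has_vector_derivative
  by (simp add: vector_derivative_works)

lemma time_deriv_eqI:
  assumes "(h has_real_derivative d) (at t within {0..T})" and "0 < T" "0 \<le> t" "t \<le> T"
  shows "time_deriv T h t = d"
  using assms unfolding time_deriv_def has_real_derivative_iff_has_vector_derivative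
  by (auto intro: vector_derivative_within_closed_interval)

lemma has_real_derivative_imp_differentiable:
  "(h has_real_derivative d) (at x within S) \<Longrightarrow> h differentiable (at x within S)"
  by (auto simp: differentiable_def has_field_derivative_def)

lemma
  assumes "classical lo hi T w"
  shows classical_cont: "continuous_on (closed_region lo hi T) (\<lambda>(y, t). w y t)"
    and classical_space_cont: "continuous_on (lateral_region lo hi T) (\<lambda>(y, t). space_deriv lo hi w y t)"
    and classical_space2_cont: "continuous_on (inner_region lo hi T)
       (\<lambda>(y, t). space_deriv lo hi (space_deriv lo hi w) y t)"
    and classical_time_cont: "continuous_on (inner_region lo hi T) (\<lambda>(y, t). time_deriv T (w y) t)"
  using assms by (simp_all only: classical_def)

lemma
  assumes "classical lo hi T w"
  shows classical_space_deriv: "(y, t) \<in> lateral_region lo hi T \<Longrightarrow>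
      ((\<lambda>\<eta>. w \<eta> t) has_real_derivative space_deriv lo hi w y t) (at y within {lo t..hi t})"
    and classical_space_deriv2: "(y, t) \<in> inner_region lo hi T \<Longrightarrow>
      ((\<lambda>\<eta>. space_deriv lo hi w \<eta> t) has_real_derivative space_deriv lo hi (space_deriv lo hi w) y t)
        (at y within {lo t..hi t})"
    and classical_time_deriv: "(y, t) \<in> inner_region lo hi T \<Longrightarrow>
      ((\<lambda>\<tau>. w y \<tau>) has_real_derivative time_deriv T (w y) t) (at t within {0..T})"
proof -
  show "((\<lambda>\<eta>. w \<eta> t) has_real_derivative space_deriv lo hi w y t) (at y within {lo t..hi t})"
    if "(y, t) \<in> lateral_region lo hi T"
    by (rule has_real_derivative_space_deriv) (use assms that in \<open>auto simp only: classical_def\<close>)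
  have *: "(\<lambda>\<eta>. space_deriv lo hi w \<eta> t) differentiable (at y within {lo t..hi t}) \<and>
      (\<lambda>\<tau>. w y \<tau>) differentiable (at t within {0..T})" if "(y, t) \<in> inner_region lo hi T"
    using assms that unfolding classical_def by fast
  show "((\<lambda>\<eta>. space_deriv lo hi w \<eta> t) has_real_derivative space_deriv lo hi (space_deriv lo hi w) y t)
        (at y within {lo t..hi t})" if "(y, t) \<in> inner_region lo hi T"
    by (rule has_real_derivative_space_deriv) (use *[OF that] in simp)
  show "((\<lambda>\<tau>. w y \<tau>) has_real_derivative time_deriv T (w y) t) (at t within {0..T})"
    if "(y, t) \<in> inner_region lo hi T"
    by (rule has_real_derivative_time_deriv) (use *[OF that] in simp)
qed

section \<open>Moving regions and the minimum principle\<close>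

locale moving_region =
  fixes lo hi :: "real \<Rightarrow> real" and T :: real
  assumes T_pos: "0 < T"
    and lo_cont: "continuous_on {0..T} lo"
    and hi_cont: "continuous_on {0..T} hi"
    and lo_less_hi: "\<And>t. t \<in> {0..T} \<Longrightarrow> lo t < hi t"
begin

abbreviation "region \<equiv> closed_region lo hi T"
abbreviation "lateral \<equiv> lateral_region lo hi T"
abbreviation "interior_pts \<equiv> inner_region lo hi T"

lemma lateral_subset: "lateral \<subseteq> region" and inner_subset: "interior_pts \<subseteq> lateral"
  by (auto simp: closed_region_def lateral_region_def inner_region_def)

lemma compact_region: "compact region"
proof -
  let ?\<psi> = "\<lambda>(\<theta>, t). (lo t + \<theta> * (hi t - lo t), t)"
  have "region = ?\<psi> ` ({0..1} \<times> {0..T})"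
  proof (intro subset_antisym subsetI)
    fix z assume "z \<in> region"
    then obtain y t where z: "z = (y, t)" and t: "0 \<le> t" "t \<le> T" "lo t \<le> y" "y \<le> hi t"
      by (auto simp: closed_region_def)
    have lt: "lo t < hi t" using lo_less_hi t by simp
    have "z = ?\<psi> ((y - lo t) / (hi t - lo t), t)"
      using lt z by simp
    moreover have "((y - lo t) / (hi t - lo t), t) \<in> {0..1} \<times> {0..T}"
      using t lt by (auto simp: divide_simps)
    ultimately show "z \<in> ?\<psi> ` ({0..1} \<times> {0..T})" by blast
  next
    fix z assume "z \<in> ?\<psi> ` ({0..1} \<times> {0..T})"
    then obtain \<theta> t where z: "z = (lo t + \<theta> * (hi t - lo t), t)"
      and t: "0 \<le> \<theta>" "\<theta> \<le> 1" "0 \<le> t" "t \<le> T"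
      unfolding image_iff mem_Times_iff by fastforce
    have "lo t < hi t" using lo_less_hi t by simp
    then have "0 \<le> \<theta> * (hi t - lo t)" "\<theta> * (hi t - lo t) \<le> 1 * (hi t - lo t)"
      using t by (auto intro!: mult_right_mono)
    then show "z \<in> region" using z t by (auto simp: closed_region_def)
  qed
  moreover have "continuous_on ({0..1} \<times> {0..T}) ?\<psi>"
    unfolding case_prod_unfold
    by (intro continuous_intros continuous_on_compose2[OF lo_cont] continuous_on_compose2[OF hi_cont]) auto
  ultimately show ?thesis
    using compact_continuous_image[of "{0..1} \<times> {0..T}" ?\<psi>] compact_Times[OF compact_Icc compact_Icc]
    by simp
qed

lemma inner_rectangle:
  assumes "(y, t) \<in> interior_pts"
  obtains e where "0 < e" "e < t"
    "\<And>y' \<tau>. \<bar>y' - y\<bar> \<le> e \<Longrightarrow> \<bar>\<tau> - t\<bar> \<le> e \<Longrightarrow> \<tau> \<le> T \<Longrightarrow> (y', \<tau>) \<in> interior_pts"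
proof -
  have t: "0 < t" "t \<le> T" "lo t < y" "y < hi t" using assms by (auto simp: inner_region_def)
  have tT: "t \<in> {0..T}" using t by simp
  obtain d1 where d1: "d1 > 0" "\<And>\<tau>. \<tau> \<in> {0..T} \<Longrightarrow> dist \<tau> t < d1 \<Longrightarrow> dist (lo \<tau>) (lo t) < (y - lo t) / 2"
    using lo_cont[unfolded continuous_on_iff, rule_format, of t "(y - lo t) / 2"] tT t by auto
  obtain d2 where d2: "d2 > 0" "\<And>\<tau>. \<tau> \<in> {0..T} \<Longrightarrow> dist \<tau> t < d2 \<Longrightarrow> dist (hi \<tau>) (hi t) < (hi t - y) / 2"
    using hi_cont[unfolded continuous_on_iff, rule_format, of t "(hi t - y) / 2"] tT t by auto
  define m1 where "m1 = min (d1/2) (d2/2)"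
  define m2 where "m2 = min ((y - lo t)/2) ((hi t - y)/2)"
  define e where "e = min m1 (min (t/2) m2)"
  have m: "0 < m1" "m1 \<le> d1/2" "m1 \<le> d2/2" "0 < m2" "m2 \<le> (y - lo t)/2" "m2 \<le> (hi t - y)/2"
    using d1(1) d2(1) t by (simp_all only: m1_def m2_def min_less_iff_conj min.cobounded1 min.cobounded2) simp_all
  have "0 < e" "e \<le> m1" "e \<le> m2" "e \<le> t/2"
    using m t unfolding e_def by (simp_all add: min.coboundedI2)
  with m have e: "0 < e" "e \<le> d1/2" "e \<le> d2/2" "e \<le> t/2" "e \<le> (y - lo t)/2" "e \<le> (hi t - y)/2"
    by linarith+
  show ?thesis
  proof (rule that[of e])
    show "0 < e" "e < t" using e t by auto
    fix y' \<tau> assume A: "\<bar>y' - y\<bar> \<le> e" "\<bar>\<tau> - t\<bar> \<le> e" "\<tau> \<le> T"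
    then have \<tau>: "\<tau> \<in> {0..T}" "0 < \<tau>" using e t by auto
    have "\<bar>lo \<tau> - lo t\<bar> < (y - lo t)/2" "\<bar>hi \<tau> - hi t\<bar> < (hi t - y)/2"
      using d1 d2 \<tau> A e by (auto simp: dist_real_def)
    then show "(y', \<tau>) \<in> interior_pts"
      using A e \<tau> unfolding inner_region_def by (auto simp: abs_if split: if_splits)
  qed
qed

text \<open>
  The weak minimum principle. If \<open>w\<close> dropped below \<open>m\<close> then \<open>w + \<epsilon> t\<close> would do so too for a small
  \<open>\<epsilon> > 0\<close>, and its minimum would be attained at an inner point. There \<open>w\<^sub>y = 0\<close>, \<open>w\<^sub>y\<^sub>y \<ge> 0\<close> and
  \<open>w\<^sub>t \<le> -\<epsilon> < 0\<close>. The only information on the equation that is needed is therefore that it forces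
  \<open>w\<^sub>t \<ge> 0\<close> at points with \<open>w\<^sub>y = 0\<close> and \<open>w\<^sub>y\<^sub>y \<ge> 0\<close>; this suits quasilinear equations, whose
  parabolicity is known only after \<open>w\<close> has been bounded below.
\<close>

lemma minimum_principle:
  assumes cl: "classical lo hi T w"
    and init: "\<And>y. y \<in> {lo 0..hi 0} \<Longrightarrow> m \<le> w y 0"
    and sides: "\<And>t. t \<in> {0<..T} \<Longrightarrow> m \<le> w (lo t) t \<and> m \<le> w (hi t) t"
    and eqn: "\<And>y t. (y, t) \<in> interior_pts \<Longrightarrow> space_deriv lo hi w y t = 0 \<Longrightarrow>
                0 \<le> space_deriv lo hi (space_deriv lo hi w) y t \<Longrightarrow> 0 \<le> time_deriv T (w y) t"
    and "(y, t) \<in> region"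
  shows "m \<le> w y t"
proof (rule ccontr)
  assume "\<not> m \<le> w y t"
  then have less: "w y t < m" by simp
  have t: "0 \<le> t" "t \<le> T" using assms by (auto simp: closed_region_def)
  define \<epsilon> where "\<epsilon> = (m - w y t) / (2 * T)"
  have \<epsilon>: "0 < \<epsilon>" using less T_pos by (simp add: \<epsilon>_def)
  have "\<epsilon> * t \<le> \<epsilon> * T" using \<epsilon> t by simp
  also have "\<epsilon> * T = (m - w y t) / 2" using T_pos by (simp add: \<epsilon>_def)
  finally have below: "w y t + \<epsilon> * t < m" using less by simp
  have "continuous_on region (\<lambda>(y, t). w y t + \<epsilon> * t)"
    using classical_cont[OF cl] unfolding case_prod_unfold by (intro continuous_intros) simp
  then obtain p0 where p0: "p0 \<in> region" and
    min: "\<And>p. p \<in> region \<Longrightarrow> (\<lambda>(y, t). w y t + \<epsilon> * t) p0 \<le> (\<lambda>(y, t). w y t + \<epsilon> * t) p"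
    using continuous_attains_inf[OF compact_region] \<open>(y,t) \<in> region\<close> by blast
  obtain y0 t0 where p0_eq: "p0 = (y0, t0)" by fastforce
  have t0: "0 \<le> t0" "t0 \<le> T" "lo t0 \<le> y0" "y0 \<le> hi t0" using p0 p0_eq by (auto simp: closed_region_def)
  have min0: "w y0 t0 + \<epsilon> * t0 \<le> w y' t' + \<epsilon> * t'" if "(y', t') \<in> region" for y' t'
    using min[OF that] p0_eq by simp
  have "w y0 t0 + \<epsilon> * t0 < m" using min0[OF \<open>(y,t) \<in> region\<close>] below by simp
  moreover have "0 \<le> \<epsilon> * t0" using \<epsilon> t0 by simp
  ultimately have low: "w y0 t0 < m" by simp
  have "t0 \<noteq> 0" using init[of y0] low t0 by (cases "t0 = 0") auto
  then have t0pos: "t0 \<in> {0<..T}" using t0 by simp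
  have "y0 \<noteq> lo t0" "y0 \<noteq> hi t0" using sides[OF t0pos] low by auto
  then have inn: "(y0, t0) \<in> interior_pts" using t0 t0pos by (auto simp: inner_region_def)
  then obtain e where e: "0 < e" "e < t0"
    and rect: "\<And>y' \<tau>. \<bar>y' - y0\<bar> \<le> e \<Longrightarrow> \<bar>\<tau> - t0\<bar> \<le> e \<Longrightarrow> \<tau> \<le> T \<Longrightarrow> (y', \<tau>) \<in> interior_pts"
    using inner_rectangle by blast
  have inR: "interior_pts \<subseteq> region" using inner_subset lateral_subset by blast
  define wy where "wy = space_deriv lo hi w"
  have Dw: "((\<lambda>\<eta>. w \<eta> t0) has_real_derivative wy \<eta> t0) (at \<eta>)" if "\<bar>\<eta> - y0\<bar> \<le> e" for \<eta>
  proof -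
    have i: "(\<eta>, t0) \<in> interior_pts" using rect[of \<eta> t0] that e t0 by simp
    then show ?thesis
      using classical_space_deriv[OF cl, of \<eta> t0] at_within_Icc_at[of "lo t0" \<eta> "hi t0"]
      by (auto simp: wy_def inner_region_def lateral_region_def)
  qed
  have Dwy: "((\<lambda>\<eta>. wy \<eta> t0) has_real_derivative space_deriv lo hi wy y0 t0) (at y0)"
    using classical_space_deriv2[OF cl inn] at_within_Icc_at[of "lo t0" y0 "hi t0"] inn
    by (simp add: wy_def inner_region_def)
  have space_min: "w y0 t0 \<le> w \<eta> t0" if "\<bar>\<eta> - y0\<bar> \<le> e" for \<eta>
    using min0[of \<eta> t0] rect[of \<eta> t0] that e t0 inR by auto
  have wy0: "wy y0 t0 = 0"
    using DERIV_local_min[OF Dw[of y0] e(1)] space_min e by (auto simp: abs_minus_commute)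
  have wyy0: "0 \<le> space_deriv lo hi wy y0 t0"
  proof (rule ccontr)
    assume "\<not> 0 \<le> space_deriv lo hi wy y0 t0"
    then obtain d where d: "d > 0" "\<And>h. h > 0 \<Longrightarrow> h < d \<Longrightarrow> wy (y0 + h) t0 < 0"
      using DERIV_neg_dec_right[OF Dwy] wy0 by auto
    define h where "h = min (d/2) e"
    have h: "0 < h" "h < d" "h \<le> e" using d e by (auto simp: h_def)
    have "\<exists>z>y0. z < y0 + h \<and> w (y0 + h) t0 - w y0 t0 = (y0 + h - y0) * wy z t0"
    proof (rule MVT2)
      show "((\<lambda>\<eta>. w \<eta> t0) has_real_derivative wy \<eta> t0) (at \<eta>)" if "y0 \<le> \<eta>" "\<eta> \<le> y0 + h" for \<eta>
        using Dw[of \<eta>] that h by simp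
    qed (use h in simp)
    then obtain z where z: "y0 < z" "z < y0 + h" "w (y0 + h) t0 - w y0 t0 = h * wy z t0" by auto
    have "wy z t0 < 0" using d(2)[of "z - y0"] z h by simp
    then have "h * wy z t0 < 0" using h by (simp add: mult_pos_neg)
    then show False using space_min[of "y0 + h"] z h by simp
  qed
  have "0 \<le> time_deriv T (w y0) t0"
    using eqn[OF inn] wy0 wyy0 by (simp add: wy_def)
  moreover have "time_deriv T (w y0) t0 + \<epsilon> \<le> 0"
  proof (rule ccontr)
    assume neg: "\<not> time_deriv T (w y0) t0 + \<epsilon> \<le> 0"
    have D: "((\<lambda>\<tau>. w y0 \<tau> + \<epsilon> * \<tau>) has_real_derivative time_deriv T (w y0) t0 + \<epsilon>) (at t0 within {0..T})"
      by (rule derivative_eq_intros classical_time_deriv[OF cl inn] refl)+ simp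
    obtain d where d: "d > 0" "\<And>h. h > 0 \<Longrightarrow> t0 - h \<in> {0..T} \<Longrightarrow> h < d \<Longrightarrow>
        w y0 (t0 - h) + \<epsilon> * (t0 - h) < w y0 t0 + \<epsilon> * t0"
      using has_real_derivative_pos_inc_left[OF D] neg by (auto simp: not_le)
    define h where "h = min (d/2) e"
    have h: "0 < h" "h < d" "h \<le> e" using d e by (auto simp: h_def)
    have "(y0, t0 - h) \<in> region" using rect[of y0 "t0 - h"] h t0 e inR by auto
    then show False using min0[of y0 "t0 - h"] d(2)[of h] h e t0 by auto
  qed
  ultimately show False using \<epsilon> by simp
qed

end

section \<open>Chain rule and implicit differentiation along curves\<close>

text \<open>
  Both the chain rule along a curve and implicit differentiation are applied to functions \<open>F\<close> whose
  \<open>y\<close>-derivative is jointly continuous but whose \<open>t\<close>-derivative is known only along the line through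
  the base point. The mean value theorem in \<open>y\<close> supplies the secant slope \<open>r\<close> that both share.
\<close>

lemma secant_slope:
  fixes F p :: "real \<Rightarrow> real \<Rightarrow> real"
  assumes e: "0 < e"
    and F: "\<And>y \<tau>. \<bar>y - y0\<bar> \<le> e \<Longrightarrow> \<bar>\<tau> - t\<bar> \<le> e \<Longrightarrow> \<tau> \<in> U \<Longrightarrow>
              ((\<lambda>\<eta>. F \<eta> \<tau>) has_real_derivative p y \<tau>) (at y)"
    and p: "continuous (at (y0, t) within UNIV \<times> U) (\<lambda>(y, \<tau>). p y \<tau>)"
    and \<gamma>: "(\<gamma> \<longlongrightarrow> y0) (at t within U)"
  obtains r where "(r \<longlongrightarrow> p y0 t) (at t within U)"
    "\<forall>\<^sub>F \<tau> in at t within U. F (\<gamma> \<tau>) \<tau> - F y0 \<tau> = r \<tau> * (\<gamma> \<tau> - y0)"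
proof -
  have ev: "\<forall>\<^sub>F \<tau> in at t within U. \<bar>\<gamma> \<tau> - y0\<bar> < e \<and> \<bar>\<tau> - t\<bar> < e \<and> \<tau> \<in> U"
  proof (intro eventually_conj)
    show "\<forall>\<^sub>F \<tau> in at t within U. \<bar>\<gamma> \<tau> - y0\<bar> < e"
      using tendstoD[OF \<gamma> e] by (simp add: dist_real_def)
    show "\<forall>\<^sub>F \<tau> in at t within U. \<bar>\<tau> - t\<bar> < e"
      using tendstoD[OF tendsto_ident_at e, of t U] by (simp add: dist_real_def)
    show "\<forall>\<^sub>F \<tau> in at t within U. \<tau> \<in> U"
      by (simp add: eventually_at_filter)
  qed
  have ex: "\<exists>\<xi>. \<bar>\<xi> - y0\<bar> \<le> \<bar>\<gamma> \<tau> - y0\<bar> \<and> F (\<gamma> \<tau>) \<tau> - F y0 \<tau> = p \<xi> \<tau> * (\<gamma> \<tau> - y0)"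
    if A: "\<bar>\<gamma> \<tau> - y0\<bar> < e \<and> \<bar>\<tau> - t\<bar> < e \<and> \<tau> \<in> U" for \<tau>
  proof -
    consider "\<gamma> \<tau> = y0" | "y0 < \<gamma> \<tau>" | "\<gamma> \<tau> < y0" by linarith
    then show ?thesis
    proof cases
      case 1 then show ?thesis by (intro exI[of _ y0]) simp
    next
      case 2
      have "\<exists>z>y0. z < \<gamma> \<tau> \<and> F (\<gamma> \<tau>) \<tau> - F y0 \<tau> = (\<gamma> \<tau> - y0) * p z \<tau>"
        by (rule MVT2[OF 2], rule F) (use A in auto)
      then obtain z where "y0 < z" "z < \<gamma> \<tau>" "F (\<gamma> \<tau>) \<tau> - F y0 \<tau> = (\<gamma> \<tau> - y0) * p z \<tau>" by blast
      then show ?thesis by (intro exI[of _ z]) (simp add: mult.commute)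
    next
      case 3
      have "\<exists>z>\<gamma> \<tau>. z < y0 \<and> F y0 \<tau> - F (\<gamma> \<tau>) \<tau> = (y0 - \<gamma> \<tau>) * p z \<tau>"
        by (rule MVT2[OF 3], rule F) (use A in auto)
      then obtain z where "\<gamma> \<tau> < z" "z < y0" "F y0 \<tau> - F (\<gamma> \<tau>) \<tau> = (y0 - \<gamma> \<tau>) * p z \<tau>" by blast
      moreover have "p z \<tau> * (\<gamma> \<tau> - y0) = - ((y0 - \<gamma> \<tau>) * p z \<tau>)" by algebra
      ultimately show ?thesis by (intro exI[of _ z]) simp
    qed
  qed
  define \<xi> where "\<xi> \<tau> = (SOME \<xi>. \<bar>\<xi> - y0\<bar> \<le> \<bar>\<gamma> \<tau> - y0\<bar> \<and> F (\<gamma> \<tau>) \<tau> - F y0 \<tau> = p \<xi> \<tau> * (\<gamma> \<tau> - y0))" for \<tau>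
  have ev\<xi>: "\<forall>\<^sub>F \<tau> in at t within U. \<bar>\<xi> \<tau> - y0\<bar> \<le> \<bar>\<gamma> \<tau> - y0\<bar> \<and>
      F (\<gamma> \<tau>) \<tau> - F y0 \<tau> = p (\<xi> \<tau>) \<tau> * (\<gamma> \<tau> - y0)"
    using ev by eventually_elim (unfold \<xi>_def, rule someI_ex[OF ex])
  have "((\<lambda>\<tau>. \<xi> \<tau> - y0) \<longlongrightarrow> 0) (at t within U)"
  proof (rule tendsto_rabs_zero_cancel, rule tendsto_sandwich[OF _ _ tendsto_const])
    show "((\<lambda>\<tau>. \<bar>\<gamma> \<tau> - y0\<bar>) \<longlongrightarrow> 0) (at t within U)"
      using \<gamma> by (intro tendsto_rabs_zero) (simp add: LIM_zero)
    show "\<forall>\<^sub>F \<tau> in at t within U. \<bar>\<xi> \<tau> - y0\<bar> \<le> \<bar>\<gamma> \<tau> - y0\<bar>"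
      using ev\<xi> by eventually_elim simp
  qed simp
  then have \<xi>: "(\<xi> \<longlongrightarrow> y0) (at t within U)" by (simp add: LIM_zero_iff)
  have "((\<lambda>\<tau>. p (\<xi> \<tau>) \<tau>) \<longlongrightarrow> p y0 t) (at t within U)"
    using continuous_within_tendsto_compose[OF p, of "\<lambda>\<tau>. (\<xi> \<tau>, \<tau>)" "at t within U"]
    using tendsto_Pair[OF \<xi> tendsto_ident_at] by (simp add: eventually_at_filter)
  moreover have "\<forall>\<^sub>F \<tau> in at t within U. F (\<gamma> \<tau>) \<tau> - F y0 \<tau> = p (\<xi> \<tau>) \<tau> * (\<gamma> \<tau> - y0)"
    using ev\<xi> by eventually_elim simp
  ultimately show ?thesis using that by blast
qed

lemma chain_rule_along_curve:
  fixes F p :: "real \<Rightarrow> real \<Rightarrow> real"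
  assumes e: "0 < e"
    and F: "\<And>y \<tau>. \<bar>y - y0\<bar> \<le> e \<Longrightarrow> \<bar>\<tau> - t\<bar> \<le> e \<Longrightarrow> \<tau> \<in> U \<Longrightarrow>
              ((\<lambda>\<eta>. F \<eta> \<tau>) has_real_derivative p y \<tau>) (at y)"
    and p: "continuous (at (y0, t) within UNIV \<times> U) (\<lambda>(y, \<tau>). p y \<tau>)"
    and Ft: "(F y0 has_real_derivative q) (at t within U)"
    and \<gamma>: "(\<gamma> has_real_derivative g) (at t within U)" "\<gamma> t = y0"
  shows "((\<lambda>\<tau>. F (\<gamma> \<tau>) \<tau>) has_real_derivative p y0 t * g + q) (at t within U)"
proof -
  have lim: "(\<gamma> \<longlongrightarrow> y0) (at t within U)"
    using DERIV_continuous[OF \<gamma>(1)] \<gamma>(2) by (simp add: continuous_within)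
  obtain r where r: "(r \<longlongrightarrow> p y0 t) (at t within U)"
    "\<forall>\<^sub>F \<tau> in at t within U. F (\<gamma> \<tau>) \<tau> - F y0 \<tau> = r \<tau> * (\<gamma> \<tau> - y0)"
    by (rule secant_slope[OF e F p lim])
  have "((\<lambda>\<tau>. r \<tau> * ((\<gamma> \<tau> - \<gamma> t) / (\<tau> - t)) + (F y0 \<tau> - F y0 t) / (\<tau> - t)) \<longlongrightarrow> p y0 t * g + q)
      (at t within U)"
    using Ft \<gamma>(1) unfolding has_field_derivative_iff by (intro tendsto_intros r)
  then have "((\<lambda>\<tau>. (F (\<gamma> \<tau>) \<tau> - F (\<gamma> t) t) / (\<tau> - t)) \<longlongrightarrow> p y0 t * g + q) (at t within U)"
  proof (rule Lim_transform_eventually)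
    show "\<forall>\<^sub>F \<tau> in at t within U. r \<tau> * ((\<gamma> \<tau> - \<gamma> t) / (\<tau> - t)) + (F y0 \<tau> - F y0 t) / (\<tau> - t) =
        (F (\<gamma> \<tau>) \<tau> - F (\<gamma> t) t) / (\<tau> - t)"
      using r(2) by eventually_elim (simp add: \<gamma>(2) flip: add_divide_distrib)
  qed
  then show ?thesis unfolding has_field_derivative_iff .
qed

lemma implicit_curve_derivative:
  fixes F p :: "real \<Rightarrow> real \<Rightarrow> real"
  assumes e: "0 < e"
    and F: "\<And>y \<tau>. \<bar>y - y0\<bar> \<le> e \<Longrightarrow> \<bar>\<tau> - t\<bar> \<le> e \<Longrightarrow> \<tau> \<in> U \<Longrightarrow>
              ((\<lambda>\<eta>. F \<eta> \<tau>) has_real_derivative p y \<tau>) (at y)"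
    and p: "continuous (at (y0, t) within UNIV \<times> U) (\<lambda>(y, \<tau>). p y \<tau>)" "p y0 t \<noteq> 0"
    and Ft: "(F y0 has_real_derivative q) (at t within U)"
    and \<gamma>: "(\<gamma> \<longlongrightarrow> y0) (at t within U)" "\<gamma> t = y0"
    and level: "\<forall>\<^sub>F \<tau> in at t within U. F (\<gamma> \<tau>) \<tau> = F y0 t"
  shows "(\<gamma> has_real_derivative - q / p y0 t) (at t within U)"
proof -
  obtain r where r: "(r \<longlongrightarrow> p y0 t) (at t within U)"
    "\<forall>\<^sub>F \<tau> in at t within U. F (\<gamma> \<tau>) \<tau> - F y0 \<tau> = r \<tau> * (\<gamma> \<tau> - y0)"
    by (rule secant_slope[OF e F p(1) \<gamma>(1)])
  have "((\<lambda>\<tau>. - ((F y0 \<tau> - F y0 t) / (\<tau> - t)) / r \<tau>) \<longlongrightarrow> - q / p y0 t) (at t within U)"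
    using Ft p(2) unfolding has_field_derivative_iff by (intro tendsto_intros r)
  then have "((\<lambda>\<tau>. (\<gamma> \<tau> - \<gamma> t) / (\<tau> - t)) \<longlongrightarrow> - q / p y0 t) (at t within U)"
  proof (rule Lim_transform_eventually)
    show "\<forall>\<^sub>F \<tau> in at t within U. - ((F y0 \<tau> - F y0 t) / (\<tau> - t)) / r \<tau> = (\<gamma> \<tau> - \<gamma> t) / (\<tau> - t)"
      using r(2) level tendsto_imp_eventually_ne[OF r(1) p(2)]
    proof eventually_elim
      case (elim \<tau>)
      then have "- (F y0 \<tau> - F y0 t) = r \<tau> * (\<gamma> \<tau> - y0)" by simp
      then have "- ((F y0 \<tau> - F y0 t) / (\<tau> - t)) = r \<tau> * (\<gamma> \<tau> - y0) / (\<tau> - t)"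
        by (metis minus_divide_left)
      then show ?case using elim(3) \<gamma>(2) by simp
    qed
  qed
  then show ?thesis unfolding has_field_derivative_iff .
qed

section \<open>Potentials of closed forms: interior curves\<close>

lemma at_within_Int_cball:
  fixes t :: real
  assumes "0 < e"
  shows "at t within ({t - e..t + e} \<inter> S) = at t within S"
  by (rule at_within_nhd[of t "{t - e<..<t + e}"]) (use assms in auto)

lemma continuous_on_slice:
  assumes "continuous_on S (\<lambda>(y, t). g y t)" "(\<lambda>y. (y, t)) ` A \<subseteq> S"
  shows "continuous_on A (\<lambda>\<eta>. g \<eta> t)"
  using continuous_on_compose2[OF assms(1) _ assms(2)] by (simp add: continuous_on_Pair)

context moving_region
begin

text \<open>
  Near an inner point the region fills the whole strip \<open>0 \<le> t \<le> T\<close>, including the one-sided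
  neighbourhoods at the final time.
\<close>

lemma at_interior_pts:
  assumes "(y, t) \<in> interior_pts"
  shows "at (y, t) within UNIV \<times> {0..T} = at (y, t) within interior_pts"
proof -
  obtain e where e: "0 < e" "e < t"
    and rect: "\<And>y' \<tau>. \<bar>y' - y\<bar> \<le> e \<Longrightarrow> \<bar>\<tau> - t\<bar> \<le> e \<Longrightarrow> \<tau> \<le> T \<Longrightarrow> (y', \<tau>) \<in> interior_pts"
    using inner_rectangle[OF assms] by blast
  let ?O = "{y - e<..<y + e} \<times> {t - e<..<t + e}"
  have "UNIV \<times> {0..T} \<inter> ?O = interior_pts \<inter> ?O"
  proof (intro subset_antisym subrelI)
    fix y' \<tau> assume "(y', \<tau>) \<in> UNIV \<times> {0..T} \<inter> ?O"
    then have "\<bar>y' - y\<bar> \<le> e" "\<bar>\<tau> - t\<bar> \<le> e" "\<tau> \<le> T" "(y', \<tau>) \<in> ?O" by auto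
    then show "(y', \<tau>) \<in> interior_pts \<inter> ?O" using rect by simp
  qed (auto simp: inner_region_def)
  then show ?thesis
    by (intro at_within_nhd[of _ ?O]) (use e in \<open>auto intro: open_Times\<close>)
qed

lemma continuous_within_strip:
  assumes "(y, t) \<in> interior_pts" "continuous_on S g" "interior_pts \<subseteq> S"
  shows "continuous (at (y, t) within UNIV \<times> {0..T}) g"
  using at_interior_pts[OF assms(1)] continuous_on_subset[OF assms(2,3)] assms(1)
  by (simp add: continuous_on_eq_continuous_within)

text \<open>
  The substitution \<open>\<eta> = lo(t) + \<theta> (y - lo(t))\<close> moves the limits of integration into the integrand.
\<close>

lemma continuous_on_integral_from_lo:
  fixes g :: "real \<Rightarrow> real \<Rightarrow> real"
  assumes g: "continuous_on region (\<lambda>(y, t). g y t)"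
  shows "continuous_on region (\<lambda>(y, t). integral {lo t..y} (\<lambda>\<eta>. g \<eta> t))"
proof -
  let ?G = "\<lambda>z \<theta>. (fst z - lo (snd z)) * g (lo (snd z) + \<theta> * (fst z - lo (snd z))) (snd z)"
  have mem: "(lo t + \<theta> * (y - lo t), t) \<in> region" if "(y, t) \<in> region" "\<theta> \<in> {0..1}" for y t \<theta>
  proof -
    have "0 \<le> \<theta> * (y - lo t)" "\<theta> * (y - lo t) \<le> y - lo t"
      using that by (auto simp: closed_region_def intro!: mult_left_le_one_le)
    then show ?thesis using that by (auto simp: closed_region_def)
  qed
  have G: "continuous_on (region \<times> {0..1}) (\<lambda>(z, \<theta>). ?G z \<theta>)"
  proof -
    have lo: "continuous_on (region \<times> {0..1}) (\<lambda>w. lo (snd (fst w)))"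
      by (rule continuous_on_compose2[OF lo_cont]) (auto intro!: continuous_intros simp: closed_region_def)
    have "continuous_on (region \<times> {0..1}) (\<lambda>w. (\<lambda>(y, t). g y t)
        (lo (snd (fst w)) + snd w * (fst (fst w) - lo (snd (fst w))), snd (fst w)))"
      by (rule continuous_on_compose2[OF g]) (use mem in \<open>auto intro!: continuous_intros lo\<close>)
    then show ?thesis
      unfolding case_prod_unfold by (auto intro!: continuous_intros lo)
  qed
  have "continuous_on region (\<lambda>z. integral {0..1} (?G z))"
    using integral_continuous_on_param[of region 0 "1::real" ?G] G by simp
  moreover have "integral {0..1} (?G z) = (\<lambda>(y, t). integral {lo t..y} (\<lambda>\<eta>. g \<eta> t)) z"
    if "z \<in> region" for z
  proof -
    obtain y t where z: "z = (y, t)" by fastforce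
    have t: "0 \<le> t" "t \<le> T" "lo t \<le> y" "y \<le> hi t" using that z by (auto simp: closed_region_def)
    have "((\<lambda>\<theta>. (y - lo t) *\<^sub>R g (lo t + \<theta> * (y - lo t)) t) has_integral
        integral {lo t + 0 * (y - lo t)..lo t + 1 * (y - lo t)} (\<lambda>\<eta>. g \<eta> t)) {0..1}"
    proof (rule has_integral_substitution)
      show "(\<lambda>\<theta>. lo t + \<theta> * (y - lo t)) ` {0..1} \<subseteq> {lo t..hi t}"
        using mem[of y t] that z by (auto simp: closed_region_def)
      show "continuous_on {lo t..hi t} (\<lambda>\<eta>. g \<eta> t)"
        by (rule continuous_on_slice[OF g]) (use t in \<open>auto simp: closed_region_def\<close>)
    qed (use t in \<open>auto intro!: derivative_eq_intros\<close>)
    then have "integral {0..1} (\<lambda>\<theta>. (y - lo t) * g (lo t + \<theta> * (y - lo t)) t) =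
        integral {lo t..y} (\<lambda>\<eta>. g \<eta> t)"
      by (intro integral_unique) simp
    then show ?thesis unfolding z by (simp only: fst_conv snd_conv case_prod_conv)
  qed
  ultimately show ?thesis by (simp cong: continuous_on_cong)
qed

end

text \<open>
  The 1-form \<open>p dy + q dt\<close> is closed, \<open>p\<^sub>t = q\<^sub>y\<close>, but both derivatives are available at inner points
  only.
\<close>

locale closed_form = moving_region +
  fixes p q p_t :: "real \<Rightarrow> real \<Rightarrow> real"
  assumes p_cont: "continuous_on region (\<lambda>(y, t). p y t)"
    and q_cont: "continuous_on lateral (\<lambda>(y, t). q y t)"
    and p_t: "\<And>y t. (y, t) \<in> interior_pts \<Longrightarrow>
          ((\<lambda>\<tau>. p y \<tau>) has_real_derivative p_t y t) (at t within {0..T})"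
    and q_y: "\<And>y t. (y, t) \<in> interior_pts \<Longrightarrow>
          ((\<lambda>\<eta>. q \<eta> t) has_real_derivative p_t y t) (at y within {lo t..hi t})"
    and p_t_cont: "continuous_on interior_pts (\<lambda>(y, t). p_t y t)"
begin

text \<open>
  Leibniz' rule for curves that stay away from the boundary. Referring both limits of integration to
  a fixed \<open>x0\<close> slightly to the left of \<open>\<alpha>(t)\<close> reduces it to the chain rule for
  \<open>F(y,t) = \<integral>\<^sub>x\<^sub>0\<^sup>y p d\<eta>\<close>, whose \<open>t\<close>-derivative is \<open>q(y,t) - q(x0,t)\<close> because \<open>p\<^sub>t = q\<^sub>y\<close>.
\<close>

lemma interior_flux:
  assumes a: "(\<alpha> t, t) \<in> interior_pts" "(\<alpha> has_real_derivative \<alpha>') (at t within {0..T})"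
    and c: "(\<gamma> t, t) \<in> interior_pts" "(\<gamma> has_real_derivative \<gamma>') (at t within {0..T})"
    and less: "\<alpha> t < \<gamma> t"
  shows "((\<lambda>\<tau>. integral {\<alpha> \<tau>..\<gamma> \<tau>} (\<lambda>\<eta>. p \<eta> \<tau>)) has_real_derivative
           (p (\<gamma> t) t * \<gamma>' + q (\<gamma> t) t) - (p (\<alpha> t) t * \<alpha>' + q (\<alpha> t) t)) (at t within {0..T})"
proof -
  have t: "0 < t" "t \<le> T" using a by (auto simp: inner_region_def)
  obtain e1 where e1: "0 < e1" "e1 < t"
    and rect1: "\<And>y' \<tau>. \<bar>y' - \<alpha> t\<bar> \<le> e1 \<Longrightarrow> \<bar>\<tau> - t\<bar> \<le> e1 \<Longrightarrow> \<tau> \<le> T \<Longrightarrow> (y', \<tau>) \<in> interior_pts"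
    using inner_rectangle[OF a(1)] by blast
  obtain e2 where e2: "0 < e2" "e2 < t"
    and rect2: "\<And>y' \<tau>. \<bar>y' - \<gamma> t\<bar> \<le> e2 \<Longrightarrow> \<bar>\<tau> - t\<bar> \<le> e2 \<Longrightarrow> \<tau> \<le> T \<Longrightarrow> (y', \<tau>) \<in> interior_pts"
    using inner_rectangle[OF c(1)] by blast
  define e where "e = min e1 e2"
  have e: "0 < e" "e < t" "e \<le> e1" "e \<le> e2" using e1 e2 by (auto simp: e_def)
  define x0 where "x0 = \<alpha> t - e"
  define x1 where "x1 = \<gamma> t + e"
  have rect: "(y, \<tau>) \<in> interior_pts" if "x0 \<le> y" "y \<le> x1" "\<bar>\<tau> - t\<bar> \<le> e" "\<tau> \<le> T" for y \<tau>
  proof -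
    have "(x0, \<tau>) \<in> interior_pts" using rect1[of x0 \<tau>] that e by (simp add: x0_def)
    moreover have "(x1, \<tau>) \<in> interior_pts" using rect2[of x1 \<tau>] that e by (simp add: x1_def)
    ultimately show ?thesis using that by (auto simp: inner_region_def)
  qed
  have inR: "interior_pts \<subseteq> region" using inner_subset lateral_subset by blast
  have pc: "continuous_on {x0..x1} (\<lambda>\<eta>. p \<eta> \<tau>)" if "\<bar>\<tau> - t\<bar> \<le> e" "\<tau> \<le> T" for \<tau>
    by (rule continuous_on_slice[OF p_cont]) (use rect that inR in auto)
  define F where "F y \<tau> = integral {x0..y} (\<lambda>\<eta>. p \<eta> \<tau>)" for y \<tau>
  have Fy: "((\<lambda>\<eta>. F \<eta> \<tau>) has_real_derivative p y \<tau>) (at y)"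
    if "x0 < y" "y < x1" "\<bar>\<tau> - t\<bar> \<le> e" "\<tau> \<le> T" for y \<tau>
    using integral_has_real_derivative[OF pc, of \<tau> y] that at_within_Icc_at[of x0 y x1]
    by (simp add: F_def)
  have Ft: "(F y has_real_derivative q y t - q x0 t) (at t within {0..T})" if y: "x0 < y" "y < x1" for y
  proof -
    let ?U = "{t - e..t + e} \<inter> {0..T}"
    have "((\<lambda>\<tau>. integral (cbox x0 y) (\<lambda>\<eta>. p \<eta> \<tau>)) has_real_derivative
        integral (cbox x0 y) (\<lambda>\<eta>. p_t \<eta> t)) (at t within ?U)"
    proof (rule leibniz_rule_field_derivative)
      show "((\<lambda>\<tau>. p \<eta> \<tau>) has_real_derivative p_t \<eta> \<tau>) (at \<tau> within ?U)"
        if "\<tau> \<in> ?U" "\<eta> \<in> cbox x0 y" for \<tau> \<eta>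
        by (rule DERIV_subset[OF p_t]) (use rect[of \<eta> \<tau>] that y in auto)
      show "(\<lambda>\<eta>. p \<eta> \<tau>) integrable_on cbox x0 y" if "\<tau> \<in> ?U" for \<tau>
        by (rule integrable_continuous, rule continuous_on_subset[OF pc]) (use that y in auto)
      have "continuous_on (?U \<times> cbox x0 y) (\<lambda>w. (\<lambda>(y, t). p_t y t) (snd w, fst w))"
        by (rule continuous_on_compose2[OF p_t_cont]) (use rect y in \<open>auto intro!: continuous_intros\<close>)
      then show "continuous_on (?U \<times> cbox x0 y) (\<lambda>(\<tau>, \<eta>). p_t \<eta> \<tau>)"
        by (simp add: case_prod_unfold)
    qed (use t e in auto)
    moreover have "((\<lambda>\<eta>. p_t \<eta> t) has_integral q y t - q x0 t) {x0..y}"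
    proof (rule fundamental_theorem_of_calculus)
      fix \<eta> assume "\<eta> \<in> {x0..y}"
      then have "(\<eta>, t) \<in> interior_pts" "{x0..y} \<subseteq> {lo t..hi t}"
        using rect[of \<eta> t] rect[of x0 t] rect[of y t] e t y by (auto simp: inner_region_def)
      then show "((\<lambda>\<eta>. q \<eta> t) has_vector_derivative p_t \<eta> t) (at \<eta> within {x0..y})"
        unfolding has_real_derivative_iff_has_vector_derivative[symmetric]
        by (intro DERIV_subset[OF q_y])
    qed (use y in simp)
    ultimately show ?thesis
      using at_within_Int_cball[OF e(1), of t "{0..T}"] by (simp add: integral_unique F_def[abs_def])
  qed
  have along: "((\<lambda>\<tau>. F (g \<tau>) \<tau>) has_real_derivative p (g t) t * g' + (q (g t) t - q x0 t)) (at t within {0..T})"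
    if g: "(g t, t) \<in> interior_pts" "(g has_real_derivative g') (at t within {0..T})"
      and bnd: "\<alpha> t \<le> g t" "g t \<le> \<gamma> t" for g g'
  proof (rule chain_rule_along_curve[OF _ _ _ _ g(2) refl])
    show "0 < e / 2" using e by simp
    show "((\<lambda>\<eta>. F \<eta> \<tau>) has_real_derivative p y \<tau>) (at y)"
      if "\<bar>y - g t\<bar> \<le> e / 2" "\<bar>\<tau> - t\<bar> \<le> e / 2" "\<tau> \<in> {0..T}" for y \<tau>
    proof (rule Fy)
      show "x0 < y" "y < x1" using that(1) bnd e(1) unfolding x0_def x1_def by linarith+
      show "\<bar>\<tau> - t\<bar> \<le> e" "\<tau> \<le> T" using that e(1) by auto
    qed
    show "continuous (at (g t, t) within UNIV \<times> {0..T}) (\<lambda>(y, \<tau>). p y \<tau>)"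
      by (rule continuous_within_strip[OF g(1) p_cont inR])
    show "(F (g t) has_real_derivative q (g t) t - q x0 t) (at t within {0..T})"
      by (rule Ft) (use bnd e in \<open>simp_all add: x0_def x1_def\<close>)
  qed
  have D: "((\<lambda>\<tau>. F (\<gamma> \<tau>) \<tau> - F (\<alpha> \<tau>) \<tau>) has_real_derivative
      (p (\<gamma> t) t * \<gamma>' + (q (\<gamma> t) t - q x0 t)) - (p (\<alpha> t) t * \<alpha>' + (q (\<alpha> t) t - q x0 t))) (at t within {0..T})"
    using less by (intro DERIV_diff along a c) auto
  have near: "\<forall>\<^sub>F \<tau> in at t within {0..T}. dist (g \<tau>) (g t) < \<epsilon>"
    if "(g has_real_derivative g') (at t within {0..T})" "0 < \<epsilon>" for g g' \<epsilon>
    using DERIV_continuous[OF that(1)] that(2) tendstoD unfolding continuous_within by blast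
  have split: "integral {\<alpha> \<tau>..\<gamma> \<tau>} (\<lambda>\<eta>. p \<eta> \<tau>) = F (\<gamma> \<tau>) \<tau> - F (\<alpha> \<tau>) \<tau>"
    if "x0 \<le> \<alpha> \<tau>" "\<alpha> \<tau> \<le> \<gamma> \<tau>" "\<gamma> \<tau> \<le> x1" "\<bar>\<tau> - t\<bar> \<le> e" "\<tau> \<le> T" for \<tau>
  proof -
    have "(\<lambda>\<eta>. p \<eta> \<tau>) integrable_on {x0..\<gamma> \<tau>}"
      by (rule integrable_continuous_interval, rule continuous_on_subset[OF pc]) (use that in auto)
    then show ?thesis
      using Henstock_Kurzweil_Integration.integral_combine[of x0 "\<alpha> \<tau>" "\<gamma> \<tau>" "\<lambda>\<eta>. p \<eta> \<tau>"] that by (simp add: F_def)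
  qed
  define m where "m = min e ((\<gamma> t - \<alpha> t) / 2)"
  have m: "0 < m" "m \<le> e" "m \<le> (\<gamma> t - \<alpha> t) / 2" using e less unfolding m_def by (simp_all only: min.cobounded1 min.cobounded2 min_less_iff_conj) simp
  have idd: "((\<lambda>\<tau>. \<tau>) has_real_derivative 1) (at t within {0..T})" by (rule DERIV_ident)
  have "\<forall>\<^sub>F \<tau> in at t within {0..T}. \<tau> \<in> {0..T}" by (simp add: eventually_at_filter)
  then have ev: "\<forall>\<^sub>F \<tau> in at t within {0..T}. integral {\<alpha> \<tau>..\<gamma> \<tau>} (\<lambda>\<eta>. p \<eta> \<tau>) = F (\<gamma> \<tau>) \<tau> - F (\<alpha> \<tau>) \<tau>"
    using near[OF a(2) m(1)] near[OF c(2) m(1)] near[OF idd e(1)]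
  proof eventually_elim
    case (elim \<tau>)
    then have "\<alpha> \<tau> < \<alpha> t + m" "\<alpha> t - m < \<alpha> \<tau>" "\<gamma> \<tau> < \<gamma> t + m" "\<gamma> t - m < \<gamma> \<tau>"
        "\<bar>\<tau> - t\<bar> < e" "\<tau> \<le> T"
      unfolding dist_real_def abs_less_iff by auto
    moreover have "2 * m \<le> \<gamma> t - \<alpha> t" using m by simp
    ultimately have "x0 \<le> \<alpha> \<tau>" "\<alpha> \<tau> \<le> \<gamma> \<tau>" "\<gamma> \<tau> \<le> x1" "\<bar>\<tau> - t\<bar> \<le> e" "\<tau> \<le> T"
      using m(2) unfolding x0_def x1_def by linarith+
    then show ?case by (rule split)
  qed
  have now: "integral {\<alpha> t..\<gamma> t} (\<lambda>\<eta>. p \<eta> t) = F (\<gamma> t) t - F (\<alpha> t) t"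
    using split[of t] e t less by (simp add: x0_def x1_def)
  show ?thesis
    unfolding has_field_derivative_cong_eventually[OF ev now] by (rule DERIV_cong[OF D]) simp
qed

end

section \<open>Potentials of closed forms: curves up to the boundary\<close>

context closed_form
begin

lemma continuous_on_p_slice: "t \<in> {0..T} \<Longrightarrow> continuous_on {lo t..hi t} (\<lambda>\<eta>. p \<eta> t)"
  by (rule continuous_on_slice[OF p_cont]) (auto simp: closed_region_def)

lemma integral_between:
  assumes t: "t \<in> {0..T}" and "lo t \<le> y1" "y1 \<le> y2" "y2 \<le> hi t"
  shows "integral {y1..y2} (\<lambda>\<eta>. p \<eta> t) =
    integral {lo t..y2} (\<lambda>\<eta>. p \<eta> t) - integral {lo t..y1} (\<lambda>\<eta>. p \<eta> t)"
proof -
  have "(\<lambda>\<eta>. p \<eta> t) integrable_on {lo t..y2}"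
    by (rule integrable_continuous_interval, rule continuous_on_subset[OF continuous_on_p_slice[OF t]])
      (use assms in auto)
  then show ?thesis
    using Henstock_Kurzweil_Integration.integral_combine[of "lo t" y1 y2 "\<lambda>\<eta>. p \<eta> t"] assms by simp
qed

text \<open>
  The formula for interior curves persists when the curves run along the lateral boundary. It is
  applied to \<open>\<alpha> + \<delta>\<close> and \<open>\<gamma> - \<delta>\<close>; as \<open>\<delta> \<rightarrow> 0\<close> the integrals converge, and their derivatives, which
  contain \<open>p\<close> and \<open>q\<close> but no longer \<open>p\<^sub>t\<close>, converge uniformly on compact time intervals away from
  \<open>t = 0\<close>.
\<close>

lemma flux:
  assumes t0: "t0 \<in> {0<..T}"
    and \<alpha>: "\<And>t. t \<in> {0<..T} \<Longrightarrow> (\<alpha> has_real_derivative \<alpha>' t) (at t within {0..T})"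
      "continuous_on {0<..T} \<alpha>'"
    and \<gamma>: "\<And>t. t \<in> {0<..T} \<Longrightarrow> (\<gamma> has_real_derivative \<gamma>' t) (at t within {0..T})"
      "continuous_on {0<..T} \<gamma>'"
    and e: "0 < e"
    and ord: "\<And>t. t \<in> {0<..T} \<Longrightarrow> \<bar>t - t0\<bar> \<le> e \<Longrightarrow> lo t \<le> \<alpha> t \<and> \<alpha> t < \<gamma> t \<and> \<gamma> t \<le> hi t"
  shows "((\<lambda>t. integral {\<alpha> t..\<gamma> t} (\<lambda>\<eta>. p \<eta> t)) has_real_derivative
           (p (\<gamma> t0) t0 * \<gamma>' t0 + q (\<gamma> t0) t0) - (p (\<alpha> t0) t0 * \<alpha>' t0 + q (\<alpha> t0) t0))
         (at t0 within {0..T})"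
proof -
  define k where "k = min e (t0 / 2)"
  have k: "0 < k" "k \<le> e" "k < t0" using e t0 by (auto simp: k_def)
  define K where "K = {t0 - k..t0 + k} \<inter> {0..T}"
  have K_eq: "K = {t0 - k..min T (t0 + k)}" using k t0 by (auto simp: K_def)
  have K_pos: "t \<in> {0<..T}" if "t \<in> K" for t using that k by (auto simp: K_def)
  have K_sub: "K \<subseteq> {0<..T}" using K_pos by blast
  have K_ord: "lo t \<le> \<alpha> t" "\<alpha> t < \<gamma> t" "\<gamma> t \<le> hi t" if "t \<in> K" for t
  proof -
    have "\<bar>t - t0\<bar> \<le> e" using that k by (auto simp: K_def)
    then show "lo t \<le> \<alpha> t" "\<alpha> t < \<gamma> t" "\<gamma> t \<le> hi t" using ord[OF K_pos[OF that]] by auto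
  qed
  have t0K: "t0 \<in> K" using t0 k by (auto simp: K_def)
  have K: "compact K" "K \<noteq> {}" "convex K" using t0K by (auto simp: K_eq)
  have cont: "continuous_on K \<alpha>" "continuous_on K \<gamma>"
  proof -
    have KT: "K \<subseteq> {0..T}" by (simp add: K_def)
    show "continuous_on K \<alpha>" by (rule DERIV_continuous_on[OF DERIV_subset[OF \<alpha>(1)[OF K_pos] KT]])
    show "continuous_on K \<gamma>" by (rule DERIV_continuous_on[OF DERIV_subset[OF \<gamma>(1)[OF K_pos] KT]])
  qed
  \<comment> \<open>The two curves are pushed inside by \<open>\<delta> n\<close>, which is less than half of their distance.\<close>
  obtain m where m: "0 < m" "\<And>t. t \<in> K \<Longrightarrow> m \<le> \<gamma> t - \<alpha> t"
  proof -
    have "continuous_on K (\<lambda>t. \<gamma> t - \<alpha> t)" by (intro continuous_intros cont)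
    then obtain t1 where "t1 \<in> K" "\<And>t. t \<in> K \<Longrightarrow> \<gamma> t1 - \<alpha> t1 \<le> \<gamma> t - \<alpha> t"
      using continuous_attains_inf[OF K(1,2)] by blast
    then show ?thesis using that[of "\<gamma> t1 - \<alpha> t1"] K_ord(2)[of t1] by simp
  qed
  define \<delta> where "\<delta> n = m / (3 * real (Suc n))" for n
  have \<delta>_pos: "0 < \<delta> n" for n using m by (simp add: \<delta>_def)
  have \<delta>_small: "2 * \<delta> n < m" for n
  proof -
    have "m * 2 < m * (3 * real (Suc n))" using m(1) by (intro mult_strict_left_mono) auto
    then show ?thesis using m(1) by (simp add: \<delta>_def divide_simps)
  qed
  have \<delta>_lim: "\<delta> \<longlonglongrightarrow> 0"
  proof -
    have "(\<lambda>n. m / 3 * inverse (real (Suc n))) \<longlonglongrightarrow> m / 3 * 0"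
      by (intro tendsto_intros LIMSEQ_inverse_real_of_nat)
    then show ?thesis by (simp add: \<delta>_def[abs_def] divide_simps)
  qed
  have inside: "lo t < \<alpha> t + \<delta> n" "\<alpha> t + \<delta> n < \<gamma> t - \<delta> n" "\<gamma> t - \<delta> n < hi t" if "t \<in> K" for t n
    using K_ord[OF that] m(2)[OF that] \<delta>_pos[of n] \<delta>_small[of n] by linarith+
  have inside_pts: "(\<alpha> t + \<delta> n, t) \<in> interior_pts" "(\<gamma> t - \<delta> n, t) \<in> interior_pts" if "t \<in> K" for t n
    using inside[OF that, of n] K_pos[OF that] by (auto simp: inner_region_def)
  define G where "G y1 y2 t = (p y2 t * \<gamma>' t + q y2 t) - (p y1 t * \<alpha>' t + q y1 t)" for y1 y2 t
  let ?G = "\<lambda>t. G (\<alpha> t) (\<gamma> t) t"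
  define J where "J n t = integral {\<alpha> t + \<delta> n..\<gamma> t - \<delta> n} (\<lambda>\<eta>. p \<eta> t)" for n t
  have J: "(J n has_real_derivative G (\<alpha> t + \<delta> n) (\<gamma> t - \<delta> n) t) (at t within K)" if "t \<in> K" for n t
  proof -
    have "((\<lambda>\<tau>. \<alpha> \<tau> + \<delta> n) has_real_derivative \<alpha>' t) (at t within {0..T})"
      "((\<lambda>\<tau>. \<gamma> \<tau> - \<delta> n) has_real_derivative \<gamma>' t) (at t within {0..T})"
      using DERIV_add[OF \<alpha>(1)[OF K_pos[OF that]] DERIV_const]
        DERIV_diff[OF \<gamma>(1)[OF K_pos[OF that]] DERIV_const] by simp_all
    from interior_flux[OF inside_pts(1)[OF that] this(1) inside_pts(2)[OF that] this(2) inside(2)[OF that]]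
    show ?thesis
      unfolding J_def[abs_def] G_def by (rule DERIV_subset) (simp add: K_def)
  qed
  \<comment> \<open>Uniform continuity of \<open>p\<close> and \<open>q\<close> on the compact slab over \<open>K\<close> makes the derivatives converge
    uniformly.\<close>
  define C where "C = region \<inter> (UNIV \<times> K)"
  have "compact C"
    unfolding C_def by (intro compact_Int_closed compact_region closed_Times compact_imp_closed[OF K(1)] closed_UNIV)
  moreover have "C \<subseteq> region" "C \<subseteq> lateral"
    using K_pos by (auto simp: C_def closed_region_def lateral_region_def)
  ultimately have uc: "uniformly_continuous_on C (\<lambda>(y, t). p y t)" "uniformly_continuous_on C (\<lambda>(y, t). q y t)"
    using continuous_on_subset[OF p_cont] continuous_on_subset[OF q_cont]
    by (auto intro!: compact_uniformly_continuous)
  have bound: "\<exists>M. \<forall>t\<in>K. \<bar>h t\<bar> \<le> M" if "continuous_on {0<..T} h" for h :: "real \<Rightarrow> real"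
  proof -
    have "bounded (h ` K)"
      using compact_continuous_image[OF continuous_on_subset[OF that K_sub] K(1)] compact_imp_bounded by blast
    then show ?thesis by (auto simp: bounded_iff)
  qed
  obtain M1 where M1: "\<forall>t\<in>K. \<bar>\<alpha>' t\<bar> \<le> M1" using bound[OF \<alpha>(2)] by blast
  obtain M2 where M2: "\<forall>t\<in>K. \<bar>\<gamma>' t\<bar> \<le> M2" using bound[OF \<gamma>(2)] by blast
  define M where "M = max 0 (max M1 M2)"
  have M: "0 \<le> M" "\<And>t. t \<in> K \<Longrightarrow> \<bar>\<alpha>' t\<bar> \<le> M" "\<And>t. t \<in> K \<Longrightarrow> \<bar>\<gamma>' t\<bar> \<le> M"
    using M1 M2 by (auto simp: M_def le_max_iff_disj)
  have unif: "\<forall>\<^sub>F n in sequentially. \<forall>t\<in>K. \<bar>G (\<alpha> t + \<delta> n) (\<gamma> t - \<delta> n) t - ?G t\<bar> \<le> \<epsilon>" if \<epsilon>: "0 < \<epsilon>" for \<epsilon>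
  proof -
    define \<epsilon>' where "\<epsilon>' = \<epsilon> / (2 * M + 2)"
    have "0 < \<epsilon>'" "\<epsilon>' * (2 * M + 2) = \<epsilon>" using \<epsilon> M(1) by (auto simp: \<epsilon>'_def)
    then have \<epsilon>': "0 < \<epsilon>'" "2 * (\<epsilon>' * M + \<epsilon>') = \<epsilon>" by (simp_all add: algebra_simps)
    obtain d1 where d1: "0 < d1" "\<And>z z'. z \<in> C \<Longrightarrow> z' \<in> C \<Longrightarrow> dist z' z < d1 \<Longrightarrow>
        dist ((\<lambda>(y, t). p y t) z') ((\<lambda>(y, t). p y t) z) < \<epsilon>'"
      using uc(1) \<epsilon>'(1) unfolding uniformly_continuous_on_def by blast
    obtain d2 where d2: "0 < d2" "\<And>z z'. z \<in> C \<Longrightarrow> z' \<in> C \<Longrightarrow> dist z' z < d2 \<Longrightarrow>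
        dist ((\<lambda>(y, t). q y t) z') ((\<lambda>(y, t). q y t) z) < \<epsilon>'"
      using uc(2) \<epsilon>'(1) unfolding uniformly_continuous_on_def by blast
    have close: "\<bar>p y' t - p y t\<bar> < \<epsilon>'" "\<bar>q y' t - q y t\<bar> < \<epsilon>'"
      if "(y, t) \<in> C" "(y', t) \<in> C" "\<bar>y' - y\<bar> < min d1 d2" for y y' t
      using d1(2)[OF that(1,2)] d2(2)[OF that(1,2)] that(3) by (simp_all add: dist_Pair_Pair dist_real_def)
    have "\<forall>\<^sub>F n in sequentially. \<delta> n < min d1 d2"
      using order_tendstoD(2)[OF \<delta>_lim, of "min d1 d2"] d1 d2 by simp
    then show ?thesis
    proof eventually_elim
      case (elim n)
      show ?case
      proof
        fix t assume t: "t \<in> K"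
        have inC: "(\<alpha> t, t) \<in> C" "(\<gamma> t, t) \<in> C" "(\<alpha> t + \<delta> n, t) \<in> C" "(\<gamma> t - \<delta> n, t) \<in> C"
          using t K_ord[OF t] inside[OF t, of n] K_pos[OF t] by (auto simp: C_def closed_region_def)
        have small: "\<bar>\<alpha> t + \<delta> n - \<alpha> t\<bar> < min d1 d2" "\<bar>\<gamma> t - \<delta> n - \<gamma> t\<bar> < min d1 d2"
          using elim \<delta>_pos[of n] by auto
        have tri: "\<bar>(a + a') - (c + c')\<bar> \<le> \<epsilon>"
          if "\<bar>a\<bar> \<le> r" "\<bar>a'\<bar> < s" "\<bar>c\<bar> \<le> r" "\<bar>c'\<bar> < s" "2 * (r + s) = \<epsilon>" for a a' c c' r s :: real
          using that by (auto simp: abs_le_iff abs_less_iff)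
        note A = close[OF inC(1,3) small(1)] and B = close[OF inC(2,4) small(2)]
        have "\<bar>(p (\<gamma> t - \<delta> n) t - p (\<gamma> t) t) * \<gamma>' t\<bar> \<le> \<epsilon>' * M"
          unfolding abs_mult using B(1) M(1) M(3)[OF t] by (intro mult_mono) auto
        moreover have "\<bar>(p (\<alpha> t + \<delta> n) t - p (\<alpha> t) t) * \<alpha>' t\<bar> \<le> \<epsilon>' * M"
          unfolding abs_mult using A(1) M(1) M(2)[OF t] by (intro mult_mono) auto
        moreover have "G (\<alpha> t + \<delta> n) (\<gamma> t - \<delta> n) t - ?G t =
            ((p (\<gamma> t - \<delta> n) t - p (\<gamma> t) t) * \<gamma>' t + (q (\<gamma> t - \<delta> n) t - q (\<gamma> t) t)) -
            ((p (\<alpha> t + \<delta> n) t - p (\<alpha> t) t) * \<alpha>' t + (q (\<alpha> t + \<delta> n) t - q (\<alpha> t) t))"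
          unfolding G_def by algebra
        ultimately show "\<bar>G (\<alpha> t + \<delta> n) (\<gamma> t - \<delta> n) t - ?G t\<bar> \<le> \<epsilon>"
          using tri[OF _ B(2) _ A(2) \<epsilon>'(2)] by simp
      qed
    qed
  qed
  have limit: "(\<lambda>n. J n t) \<longlonglongrightarrow> integral {\<alpha> t..\<gamma> t} (\<lambda>\<eta>. p \<eta> t)" if t: "t \<in> K" for t
  proof -
    have tT: "t \<in> {0..T}" using K_pos[OF t] by auto
    note ord = K_ord[OF t] inside[OF t]
    have I: "continuous_on {lo t..hi t} (\<lambda>y. integral {lo t..y} (\<lambda>\<eta>. p \<eta> t))"
      by (intro indefinite_integral_continuous_1 integrable_continuous_interval continuous_on_p_slice tT)
    have "(\<lambda>n. integral {lo t..\<gamma> t - \<delta> n} (\<lambda>\<eta>. p \<eta> t) - integral {lo t..\<alpha> t + \<delta> n} (\<lambda>\<eta>. p \<eta> t))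
        \<longlonglongrightarrow> integral {lo t..\<gamma> t} (\<lambda>\<eta>. p \<eta> t) - integral {lo t..\<alpha> t} (\<lambda>\<eta>. p \<eta> t)"
    proof (intro tendsto_diff continuous_on_tendsto_compose[OF I])
      show "(\<lambda>n. \<gamma> t - \<delta> n) \<longlonglongrightarrow> \<gamma> t" "(\<lambda>n. \<alpha> t + \<delta> n) \<longlonglongrightarrow> \<alpha> t"
        using tendsto_diff[OF tendsto_const \<delta>_lim] tendsto_add[OF tendsto_const \<delta>_lim] by force+
      have "\<gamma> t - \<delta> n \<in> {lo t..hi t}" "\<alpha> t + \<delta> n \<in> {lo t..hi t}" for n
        using ord(1,2,3) ord(4,5,6)[of n] by auto
      then show "\<forall>\<^sub>F n in sequentially. \<gamma> t - \<delta> n \<in> {lo t..hi t}"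
        "\<forall>\<^sub>F n in sequentially. \<alpha> t + \<delta> n \<in> {lo t..hi t}" by auto
    qed (use ord in auto)
    moreover have "J n t = integral {lo t..\<gamma> t - \<delta> n} (\<lambda>\<eta>. p \<eta> t) - integral {lo t..\<alpha> t + \<delta> n} (\<lambda>\<eta>. p \<eta> t)" for n
      unfolding J_def by (rule integral_between[OF tT]) (use ord(4,5,6)[of n] in auto)
    ultimately show ?thesis
      using integral_between[OF tT, of "\<alpha> t" "\<gamma> t"] ord by simp
  qed
  have "\<exists>g. \<forall>t\<in>K. (\<lambda>n. J n t) \<longlonglongrightarrow> g t \<and> (g has_derivative (*) (?G t)) (at t within K)"
  proof (rule has_derivative_sequence[where f = J and ?x0.0 = t0, OF K(3)])
    show "(J n has_derivative (*) (G (\<alpha> t + \<delta> n) (\<gamma> t - \<delta> n) t)) (at t within K)" if "t \<in> K" for n t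
      using J[OF that] unfolding has_field_derivative_def .
    show "\<forall>\<^sub>F n in sequentially. \<forall>t\<in>K. \<forall>h. norm (G (\<alpha> t + \<delta> n) (\<gamma> t - \<delta> n) t * h - ?G t * h) \<le> \<epsilon> * norm h"
      if "0 < \<epsilon>" for \<epsilon>
      using unif[OF that]
    proof eventually_elim
      case (elim n)
      then show ?case
        by (auto simp: abs_mult simp flip: left_diff_distrib intro!: mult_right_mono)
    qed
    show "t0 \<in> K" "(\<lambda>n. J n t0) \<longlonglongrightarrow> integral {\<alpha> t0..\<gamma> t0} (\<lambda>\<eta>. p \<eta> t0)"
      by (fact t0K, fact limit[OF t0K])
  qed
  then obtain g where g: "\<And>t. t \<in> K \<Longrightarrow> (\<lambda>n. J n t) \<longlonglongrightarrow> g t"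
    "(g has_real_derivative ?G t0) (at t0 within K)"
    using t0K unfolding has_field_derivative_def by blast
  have "g t = integral {\<alpha> t..\<gamma> t} (\<lambda>\<eta>. p \<eta> t)" if "t \<in> K" for t
    using LIMSEQ_unique[OF g(1)[OF that] limit[OF that]] .
  then have "((\<lambda>t. integral {\<alpha> t..\<gamma> t} (\<lambda>\<eta>. p \<eta> t)) has_real_derivative ?G t0) (at t0 within K)"
    by (intro has_field_derivative_transform_within[OF g(2) zero_less_one t0K])
  then show ?thesis
    unfolding G_def K_def at_within_Int_cball[OF k(1)] .
qed

end

section \<open>A change of the space variable\<close>

text \<open>
  \<open>P(y,t)\<close> becomes the new space variable. Its derivatives \<open>p = P\<^sub>y\<close> and \<open>q = P\<^sub>t\<close> are only required
  as far as the derivatives of a classical solution exist.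
\<close>

locale coordinate_change = moving_region +
  fixes P p q p_y :: "real \<Rightarrow> real \<Rightarrow> real"
  assumes P_cont: "continuous_on region (\<lambda>(y, t). P y t)"
    and P_strict_mono: "\<And>t y y'. t \<in> {0..T} \<Longrightarrow> lo t \<le> y \<Longrightarrow> y < y' \<Longrightarrow> y' \<le> hi t \<Longrightarrow> P y t < P y' t"
    and P_y: "\<And>y t. (y, t) \<in> lateral \<Longrightarrow>
          ((\<lambda>\<eta>. P \<eta> t) has_real_derivative p y t) (at y within {lo t..hi t})"
    and P_t: "\<And>y t. (y, t) \<in> interior_pts \<Longrightarrow> ((\<lambda>\<tau>. P y \<tau>) has_real_derivative q y t) (at t within {0..T})"
    and p_pos_lateral: "\<And>y t. (y, t) \<in> lateral \<Longrightarrow> 0 < p y t"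
    and p_cont_lateral: "continuous_on lateral (\<lambda>(y, t). p y t)"
    and p_y: "\<And>y t. (y, t) \<in> interior_pts \<Longrightarrow>
          ((\<lambda>\<eta>. p \<eta> t) has_real_derivative p_y y t) (at y within {lo t..hi t})"
    and p_y_cont: "continuous_on interior_pts (\<lambda>(y, t). p_y y t)"
    and q_cont_inner: "continuous_on interior_pts (\<lambda>(y, t). q y t)"
begin

abbreviation "LO \<equiv> \<lambda>t. P (lo t) t"
abbreviation "HI \<equiv> \<lambda>t. P (hi t) t"
abbreviation "X \<equiv> \<lambda>z t. inv_into {lo t..hi t} (\<lambda>y. P y t) z"

lemma continuous_on_P_along:
  assumes "continuous_on {0..T} \<gamma>" "\<And>t. t \<in> {0..T} \<Longrightarrow> lo t \<le> \<gamma> t \<and> \<gamma> t \<le> hi t"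
  shows "continuous_on {0..T} (\<lambda>t. P (\<gamma> t) t)"
proof -
  have "continuous_on {0..T} (\<lambda>t. (\<lambda>(y, t). P y t) (\<gamma> t, t))"
    by (rule continuous_on_compose2[OF P_cont])
      (use assms in \<open>auto intro!: continuous_intros simp: closed_region_def\<close>)
  then show ?thesis by simp
qed

sublocale image: moving_region LO HI T
proof
  show "continuous_on {0..T} LO" "continuous_on {0..T} HI"
    by (rule continuous_on_P_along[OF lo_cont] continuous_on_P_along[OF hi_cont],
        use lo_less_hi in force)+
  show "LO t < HI t" if "t \<in> {0..T}" for t
    using P_strict_mono[OF that] lo_less_hi[OF that] by simp
qed (rule T_pos)

lemma inj_on_P: "t \<in> {0..T} \<Longrightarrow> inj_on (\<lambda>y. P y t) {lo t..hi t}"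
proof (rule linorder_inj_onI')
  fix y y' assume "t \<in> {0..T}" "y \<in> {lo t..hi t}" "y' \<in> {lo t..hi t}" "y < y'"
  then show "P y t \<noteq> P y' t" using P_strict_mono[of t y y'] by simp
qed

lemma X_P: "t \<in> {0..T} \<Longrightarrow> lo t \<le> y \<Longrightarrow> y \<le> hi t \<Longrightarrow> X (P y t) t = y"
  by (simp add: inv_into_f_f[OF inj_on_P])

lemma P_range: "t \<in> {0..T} \<Longrightarrow> lo t \<le> y \<Longrightarrow> y \<le> hi t \<Longrightarrow> LO t \<le> P y t \<and> P y t \<le> HI t"
  using P_strict_mono[of t "lo t" y] P_strict_mono[of t y "hi t"]
  by (cases "y = lo t"; cases "y = hi t") (simp_all add: less_imp_le)

lemma P_image: 
  assumes t: "t \<in> {0..T}"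
  shows "(\<lambda>y. P y t) ` {lo t..hi t} = {LO t..HI t}"
proof (intro subset_antisym subsetI)
  fix z assume "z \<in> {LO t..HI t}"
  moreover have "continuous_on {lo t..hi t} (\<lambda>y. P y t)"
    by (rule continuous_on_slice[OF P_cont]) (use t in \<open>auto simp: closed_region_def\<close>)
  ultimately obtain y where "lo t \<le> y" "y \<le> hi t" "P y t = z"
    using IVT'[of "\<lambda>y. P y t" "lo t" z "hi t"] lo_less_hi[OF t] by auto
  then show "z \<in> (\<lambda>y. P y t) ` {lo t..hi t}" by auto
qed (use P_range[OF t] in auto)

lemma X_bounds: 
  assumes "t \<in> {0..T}" "LO t \<le> z" "z \<le> HI t"
  shows "lo t \<le> X z t" "X z t \<le> hi t" and P_X: "P (X z t) t = z"
proof -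
  have z: "z \<in> (\<lambda>y. P y t) ` {lo t..hi t}" using P_image assms by simp
  show "lo t \<le> X z t" "X z t \<le> hi t" using inv_into_into[OF z] by auto
  show "P (X z t) t = z" using f_inv_into_f[OF z] .
qed

lemma X_lateral: "(z, t) \<in> image.lateral \<Longrightarrow> (X z t, t) \<in> lateral"
  using X_bounds[of t z] by (auto simp: lateral_region_def)

lemma X_interior:
  assumes "(z, t) \<in> image.interior_pts"
  shows "(X z t, t) \<in> interior_pts"
proof -
  have t: "0 < t" "t \<le> T" "LO t < z" "z < HI t" using assms by (auto simp: inner_region_def)
  then have *: "lo t \<le> X z t" "X z t \<le> hi t" "P (X z t) t = z" using X_bounds[of t z] P_X[of t z] by auto
  moreover have "X z t \<noteq> lo t" using *(3) t(3) by (intro notI) simp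
  moreover have "X z t \<noteq> hi t" using *(3) t(4) by (intro notI) simp
  ultimately show ?thesis using t by (auto simp: inner_region_def)
qed

text \<open>
  The closed region is compact, so that the inverse of \<open>(y,t) \<mapsto> (P(y,t),t)\<close> is continuous.
\<close>

lemma X_cont: "continuous_on image.region (\<lambda>(z, t). X z t)"
proof -
  let ?\<Phi> = "\<lambda>(y, t). (P y t, t)"
  have "?\<Phi> ` region = image.region"
  proof (intro subset_antisym subsetI)
    fix w assume "w \<in> image.region"
    then obtain z t where w: "w = (z, t)" and t: "t \<in> {0..T}" "LO t \<le> z" "z \<le> HI t"
      by (auto simp: closed_region_def)
    have "w = ?\<Phi> (X z t, t)" using w P_X[OF t] by simp
    moreover have "(X z t, t) \<in> region" using X_bounds[OF t] t(1) by (simp add: closed_region_def)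
    ultimately show "w \<in> ?\<Phi> ` region" by blast
  next
    fix w assume "w \<in> ?\<Phi> ` region"
    then obtain y t where w: "w = (P y t, t)" and t: "t \<in> {0..T}" "lo t \<le> y" "y \<le> hi t"
      by (auto simp: closed_region_def)
    show "w \<in> image.region" using P_range[OF t] t(1) w by (simp add: closed_region_def)
  qed
  moreover have "continuous_on region ?\<Phi>"
    using continuous_on_Pair[OF P_cont continuous_on_snd[OF continuous_on_id]] by (simp add: case_prod_unfold)
  then have "continuous_on (?\<Phi> ` region) (\<lambda>(z, t). (X z t, t))"
  proof (rule continuous_on_inv[OF _ compact_region], intro ballI)
    fix w assume "w \<in> region"
    then obtain y t where w: "w = (y, t)" and t: "t \<in> {0..T}" "lo t \<le> y" "y \<le> hi t"
      by (auto simp: closed_region_def)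
    show "(\<lambda>(z, t). (X z t, t)) (?\<Phi> w) = w" using X_P[OF t] by (simp add: w)
  qed
  ultimately have "continuous_on image.region (\<lambda>(z, t). (X z t, t))" by simp
  from continuous_on_fst[OF this] show ?thesis by (simp add: case_prod_unfold)
qed

lemma continuous_on_compose_X:
  assumes "continuous_on S (\<lambda>(y, t). g y t)"
    and "R \<subseteq> image.region" "\<And>z t. (z, t) \<in> R \<Longrightarrow> (X z t, t) \<in> S"
  shows "continuous_on R (\<lambda>(z, t). g (X z t) t)"
proof -
  let ?\<Psi> = "\<lambda>w. ((\<lambda>(z, t). X z t) w, snd w)"
  have "continuous_on R ?\<Psi>"
    by (rule continuous_on_Pair[OF continuous_on_subset[OF X_cont assms(2)] continuous_on_snd[OF continuous_on_id]])
  moreover have "?\<Psi> ` R \<subseteq> S"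
  proof (rule image_subsetI)
    fix w assume "w \<in> R"
    then show "?\<Psi> w \<in> S" using assms(3)[of "fst w" "snd w"] by (simp add: case_prod_unfold)
  qed
  ultimately have "continuous_on R (\<lambda>w. (\<lambda>(y, t). g y t) (?\<Psi> w))"
    by (rule continuous_on_compose2[OF assms(1)])
  then show ?thesis
  proof (rule continuous_on_eq)
    fix w assume "w \<in> R"
    show "(\<lambda>(y, t). g y t) (?\<Psi> w) = (\<lambda>(z, t). g (X z t) t) w" by (cases w) simp
  qed
qed

lemma X_z:
  assumes zt: "(z, t) \<in> image.lateral"
  shows "((\<lambda>\<zeta>. X \<zeta> t) has_real_derivative 1 / p (X z t) t) (at z within {LO t..HI t})"
proof -
  have t: "t \<in> {0..T}" "LO t \<le> z" "z \<le> HI t" using zt by (auto simp: lateral_region_def)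
  note lat = X_lateral[OF zt]
  have p0: "p (X z t) t \<noteq> 0" using p_pos_lateral[OF lat] by simp
  have "((\<lambda>\<zeta>. X \<zeta> t) has_derivative (*) (1 / p (X z t) t))
      (at (P (X z t) t) within (\<lambda>y. P y t) ` {lo t..hi t})"
  proof (rule has_derivative_inverse_within)
    show "((\<lambda>y. P y t) has_derivative (*) (p (X z t) t)) (at (X z t) within {lo t..hi t})"
      using P_y[OF lat] unfolding has_field_derivative_def .
    have "continuous_on {LO t..HI t} (\<lambda>\<zeta>. X \<zeta> t)"
      by (rule continuous_on_slice[OF X_cont]) (use t in \<open>auto simp: closed_region_def\<close>)
    then show "continuous (at (P (X z t) t) within (\<lambda>y. P y t) ` {lo t..hi t}) (\<lambda>\<zeta>. X \<zeta> t)"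
      unfolding P_image[OF t(1)] P_X[OF t] using t by (simp add: continuous_on_eq_continuous_within)
    show "X z t \<in> {lo t..hi t}" using X_bounds[OF t] by simp
    show "linear ((*) (1 / p (X z t) t))" by (rule bounded_linear.linear[OF bounded_linear_mult_right])
    show "(*) (1 / p (X z t) t) \<circ> (*) (p (X z t) t) = id" using p0 by auto
    show "X (P y t) t = y" if "y \<in> {lo t..hi t}" for y using X_P[OF t(1)] that by simp
  qed
  then show ?thesis unfolding P_image[OF t(1)] P_X[OF t] has_field_derivative_def .
qed

lemma has_real_derivative_compose_X:
  assumes zt: "(z, t) \<in> image.lateral"
    and g: "(g has_real_derivative d) (at (X z t) within {lo t..hi t})"
  shows "((\<lambda>\<zeta>. g (X \<zeta> t)) has_real_derivative d / p (X z t) t) (at z within {LO t..HI t})"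
proof -
  have "t \<in> {0..T}" using zt by (auto simp: lateral_region_def)
  then have "(\<lambda>\<zeta>. X \<zeta> t) ` {LO t..HI t} \<subseteq> {lo t..hi t}" using X_bounds by auto
  from DERIV_image_chain[OF DERIV_subset[OF g this] X_z[OF zt]]
  show ?thesis by (simp add: o_def)
qed

lemma rectangle_derivative:
  assumes "(y0, t) \<in> interior_pts"
    and F: "\<And>y \<tau>. (y, \<tau>) \<in> lateral \<Longrightarrow>
          ((\<lambda>\<eta>. F \<eta> \<tau>) has_real_derivative F' y \<tau>) (at y within {lo \<tau>..hi \<tau>})"
  obtains e where "0 < e" "\<And>y \<tau>. \<bar>y - y0\<bar> \<le> e \<Longrightarrow> \<bar>\<tau> - t\<bar> \<le> e \<Longrightarrow> \<tau> \<in> {0..T} \<Longrightarrow>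
      ((\<lambda>\<eta>. F \<eta> \<tau>) has_real_derivative F' y \<tau>) (at y)"
proof -
  obtain e where e: "0 < e" "e < t" and rect: "\<And>y' \<tau>. \<bar>y' - y0\<bar> \<le> e \<Longrightarrow> \<bar>\<tau> - t\<bar> \<le> e \<Longrightarrow> \<tau> \<le> T \<Longrightarrow> (y', \<tau>) \<in> interior_pts"
    using inner_rectangle[OF assms(1)] by blast
  show ?thesis
  proof (rule that[OF e(1)])
    fix y \<tau> assume "\<bar>y - y0\<bar> \<le> e" "\<bar>\<tau> - t\<bar> \<le> e" "\<tau> \<in> {0..T}"
    then have i: "(y, \<tau>) \<in> interior_pts" using rect by simp
    then have lat: "(y, \<tau>) \<in> lateral" using inner_subset by blast
    show "((\<lambda>\<eta>. F \<eta> \<tau>) has_real_derivative F' y \<tau>) (at y)"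
      using F[OF lat] at_within_Icc_at[of "lo \<tau>" y "hi \<tau>"] i by (simp add: inner_region_def)
  qed
qed

text \<open>
  \<open>X(z,\<cdot>)\<close> is a level curve of \<open>P\<close>, along which \<open>p dy + q dt = 0\<close>.
\<close>

lemma X_t:
  assumes zt: "(z, t) \<in> image.interior_pts"
  shows "((\<lambda>\<tau>. X z \<tau>) has_real_derivative - q (X z t) t / p (X z t) t) (at t within {0..T})"
proof -
  have t: "t \<in> {0..T}" "LO t \<le> z" "z \<le> HI t" using zt by (auto simp: inner_region_def)
  note int = X_interior[OF zt]
  obtain e where e: "0 < e" "\<And>y \<tau>. \<bar>y - X z t\<bar> \<le> e \<Longrightarrow> \<bar>\<tau> - t\<bar> \<le> e \<Longrightarrow> \<tau> \<in> {0..T} \<Longrightarrow>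
      ((\<lambda>\<eta>. P \<eta> \<tau>) has_real_derivative p y \<tau>) (at y)"
    using rectangle_derivative[OF int P_y] by blast
  obtain e' where e': "0 < e'" "e' < t"
    and rect: "\<And>z' \<tau>. \<bar>z' - z\<bar> \<le> e' \<Longrightarrow> \<bar>\<tau> - t\<bar> \<le> e' \<Longrightarrow> \<tau> \<le> T \<Longrightarrow> (z', \<tau>) \<in> image.interior_pts"
    using image.inner_rectangle[OF zt] by blast
  show ?thesis
  proof (rule implicit_curve_derivative[OF e])
    show "continuous (at (X z t, t) within UNIV \<times> {0..T}) (\<lambda>(y, \<tau>). p y \<tau>)"
      by (rule continuous_within_strip[OF int p_cont_lateral inner_subset])
    show "p (X z t) t \<noteq> 0" using p_pos_lateral[of "X z t" t] int inner_subset by auto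
    show "(P (X z t) has_real_derivative q (X z t) t) (at t within {0..T})" by (rule P_t[OF int])
    have "continuous (at (z, t) within UNIV \<times> {0..T}) (\<lambda>(z, t). X z t)"
      using image.continuous_within_strip[OF zt X_cont] image.inner_subset image.lateral_subset by blast
    then show "(X z \<longlongrightarrow> X z t) (at t within {0..T})"
      using continuous_within_tendsto_compose[of "(z, t)" "UNIV \<times> {0..T}" "\<lambda>(z, t). X z t"
          "\<lambda>\<tau>. (z, \<tau>)" "at t within {0..T}"]
      by (simp add: eventually_at_filter tendsto_Pair)
    have "\<forall>\<^sub>F \<tau> in at t within {0..T}. dist \<tau> t < e'"
      using tendstoD[OF tendsto_ident_at e'(1)] .
    moreover have "\<forall>\<^sub>F \<tau> in at t within {0..T}. \<tau> \<in> {0..T}" by (simp add: eventually_at_filter)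
    ultimately show "\<forall>\<^sub>F \<tau> in at t within {0..T}. P (X z \<tau>) \<tau> = P (X z t) t"
    proof eventually_elim
      case (elim \<tau>)
      then have "(z, \<tau>) \<in> image.interior_pts" using rect[of z \<tau>] e' by (simp add: dist_real_def)
      then show ?case using elim P_X[of \<tau> z] P_X[OF t] by (simp add: inner_region_def)
    qed
  qed simp_all
qed

context
  fixes w :: "real \<Rightarrow> real \<Rightarrow> real"
  assumes cl: "classical lo hi T w"
begin

abbreviation "W \<equiv> change_var lo hi P w"
abbreviation "w_y \<equiv> space_deriv lo hi w"
abbreviation "w_yy \<equiv> space_deriv lo hi (space_deriv lo hi w)"

lemma W_eq: "W = (\<lambda>z t. w (X z t) t)"
  by (simp add: change_var_def fun_eq_iff)

lemma W_P: "t \<in> {0..T} \<Longrightarrow> lo t \<le> y \<Longrightarrow> y \<le> hi t \<Longrightarrow> W (P y t) t = w y t"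
  by (simp add: change_var_def X_P)

lemma W_z:
  assumes "(z, t) \<in> image.lateral"
  shows "((\<lambda>\<zeta>. W \<zeta> t) has_real_derivative w_y (X z t) t / p (X z t) t) (at z within {LO t..HI t})"
  unfolding W_eq
  by (rule has_real_derivative_compose_X[OF assms classical_space_deriv[OF cl X_lateral[OF assms]]])

lemma space_deriv_W: 
  assumes "(z, t) \<in> image.lateral"
  shows "space_deriv LO HI W z t = w_y (X z t) t / p (X z t) t"
  by (rule space_deriv_eqI[where lo = LO and hi = HI and w = W and t = t, OF W_z[OF assms]])
    (use assms image.lo_less_hi[of t] in \<open>auto simp: lateral_region_def\<close>)

lemma W_zz:
  assumes "(z, t) \<in> image.interior_pts"
  shows "((\<lambda>\<zeta>. space_deriv LO HI W \<zeta> t) has_real_derivative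
      (w_yy (X z t) t * p (X z t) t - w_y (X z t) t * p_y (X z t) t) / (p (X z t) t) ^ 3)
      (at z within {LO t..HI t})"
proof -
  have lat: "(z, t) \<in> image.lateral" using assms image.inner_subset by blast
  note int = X_interior[OF assms]
  have p0: "p (X z t) t \<noteq> 0" using p_pos_lateral[of "X z t" t] int inner_subset by auto
  have "((\<lambda>\<eta>. w_y \<eta> t / p \<eta> t) has_real_derivative
      (w_yy (X z t) t * p (X z t) t - w_y (X z t) t * p_y (X z t) t) / (p (X z t) t * p (X z t) t))
      (at (X z t) within {lo t..hi t})"
    by (rule DERIV_divide[OF classical_space_deriv2[OF cl int] p_y[OF int] p0])
  from has_real_derivative_compose_X[OF lat this]
  have "((\<lambda>\<zeta>. w_y (X \<zeta> t) t / p (X \<zeta> t) t) has_real_derivative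
      (w_yy (X z t) t * p (X z t) t - w_y (X z t) t * p_y (X z t) t) / (p (X z t) t) ^ 3)
      (at z within {LO t..HI t})"
    by (simp add: power3_eq_cube)
  then show ?thesis
    by (rule has_field_derivative_transform_within[OF _ zero_less_one])
      (use lat in \<open>auto simp: space_deriv_W lateral_region_def\<close>)
qed

lemma space_deriv2_W: 
  assumes "(z, t) \<in> image.interior_pts"
  shows "space_deriv LO HI (space_deriv LO HI W) z t =
    (w_yy (X z t) t * p (X z t) t - w_y (X z t) t * p_y (X z t) t) / (p (X z t) t) ^ 3"
  by (rule space_deriv_eqI[where lo = LO and hi = HI and w = "space_deriv LO HI W" and t = t, OF W_zz[OF assms]])
    (use assms image.lo_less_hi[of t] in \<open>auto simp: inner_region_def\<close>)

lemma W_t: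
  assumes "(z, t) \<in> image.interior_pts"
  shows "(W z has_real_derivative
      w_y (X z t) t * (- q (X z t) t / p (X z t) t) + time_deriv T (w (X z t)) t) (at t within {0..T})"
proof -
  note int = X_interior[OF assms]
  obtain e where e: "0 < e" "\<And>y \<tau>. \<bar>y - X z t\<bar> \<le> e \<Longrightarrow> \<bar>\<tau> - t\<bar> \<le> e \<Longrightarrow> \<tau> \<in> {0..T} \<Longrightarrow>
      ((\<lambda>\<eta>. w \<eta> \<tau>) has_real_derivative w_y y \<tau>) (at y)"
    using rectangle_derivative[OF int classical_space_deriv[OF cl]] by blast
  show ?thesis
    unfolding W_eq
    by (rule chain_rule_along_curve[OF e continuous_within_strip[OF int classical_space_cont[OF cl] inner_subset]
          classical_time_deriv[OF cl int] X_t[OF assms] refl])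
qed

lemma time_deriv_W: 
  assumes "(z, t) \<in> image.interior_pts"
  shows "time_deriv T (W z) t =
    w_y (X z t) t * (- q (X z t) t / p (X z t) t) + time_deriv T (w (X z t)) t"
  by (rule time_deriv_eqI[OF W_t[OF assms] T_pos]) (use assms in \<open>auto simp: inner_region_def\<close>)

lemma classical_W: "classical LO HI T W"
proof -
  have ne: "p (X z t) t \<noteq> 0" if "(z, t) \<in> image.lateral" for z t
    using p_pos_lateral[OF X_lateral[OF that]] by simp
  have lat: "(z, t) \<in> image.lateral" if "(z, t) \<in> image.interior_pts" for z t
    using that image.inner_subset by blast
  have latR: "image.lateral \<subseteq> image.region" by (rule image.lateral_subset)
  have intR: "image.interior_pts \<subseteq> image.region" using image.inner_subset latR by blast
  have lateral_comp: "continuous_on image.lateral (\<lambda>(z, t). g (X z t) t)"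
    if "continuous_on lateral (\<lambda>(y, t). g y t)" for g :: "real \<Rightarrow> real \<Rightarrow> real"
    by (rule continuous_on_compose_X[OF that latR]) (rule X_lateral)
  have inner_comp: "continuous_on image.interior_pts (\<lambda>(z, t). g (X z t) t)"
    if "continuous_on interior_pts (\<lambda>(y, t). g y t)" for g :: "real \<Rightarrow> real \<Rightarrow> real"
    by (rule continuous_on_compose_X[OF that intR]) (rule X_interior)
  note on_inner = continuous_on_subset[OF _ inner_subset]
  note lateral_conts = lateral_comp[of w_y, OF classical_space_cont[OF cl]] lateral_comp[of p, OF p_cont_lateral]
  note inner_conts = inner_comp[of w_y, OF on_inner[OF classical_space_cont[OF cl]]]
    inner_comp[of w_yy, OF classical_space2_cont[OF cl]]
    inner_comp[of "\<lambda>y t. time_deriv T (w y) t", OF classical_time_cont[OF cl]]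
    inner_comp[of p, OF on_inner[OF p_cont_lateral]] inner_comp[of p_y, OF p_y_cont] inner_comp[of q, OF q_cont_inner]
  have "continuous_on image.region (\<lambda>(z, t). W z t)"
    unfolding W_eq
    by (rule continuous_on_compose_X[OF classical_cont[OF cl] subset_refl])
      (use X_bounds in \<open>auto simp: closed_region_def\<close>)
  moreover have "continuous_on image.lateral (\<lambda>(z, t). space_deriv LO HI W z t)"
  proof -
    have "continuous_on image.lateral (\<lambda>(z, t). w_y (X z t) t / p (X z t) t)"
      using lateral_conts ne unfolding case_prod_unfold by (intro continuous_on_divide) auto
    then show ?thesis by (rule continuous_on_eq) (auto simp: space_deriv_W)
  qed
  moreover have "continuous_on image.interior_pts (\<lambda>(z, t). space_deriv LO HI (space_deriv LO HI W) z t)"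
  proof -
    have "continuous_on image.interior_pts (\<lambda>(z, t).
        (w_yy (X z t) t * p (X z t) t - w_y (X z t) t * p_y (X z t) t) / (p (X z t) t) ^ 3)"
      using inner_conts ne[OF lat] unfolding case_prod_unfold
      by (intro continuous_on_divide continuous_on_diff continuous_on_mult continuous_on_power) auto
    then show ?thesis by (rule continuous_on_eq) (auto simp: space_deriv2_W)
  qed
  moreover have "continuous_on image.interior_pts (\<lambda>(z, t). time_deriv T (W z) t)"
  proof -
    have "continuous_on image.interior_pts (\<lambda>(z, t).
        w_y (X z t) t * (- q (X z t) t / p (X z t) t) + time_deriv T (w (X z t)) t)"
      using inner_conts ne[OF lat] unfolding case_prod_unfold
      by (intro continuous_on_add continuous_on_divide continuous_on_mult continuous_on_minus) auto
    then show ?thesis by (rule continuous_on_eq) (auto simp: time_deriv_W)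
  qed
  ultimately show ?thesis
    unfolding classical_def
    by (auto intro!: has_real_derivative_imp_differentiable W_z W_zz W_t)
qed

end

end

text \<open>
  The potential of a closed form with \<open>p > 0\<close> is an admissible new space variable. The function \<open>A\<close>
  carries its values along the left boundary, where it has to grow at the rate \<open>p lo' + q\<close>.
\<close>

locale potential = closed_form +
  fixes P p_y :: "real \<Rightarrow> real \<Rightarrow> real" and A lo' :: "real \<Rightarrow> real"
  assumes P_def: "\<And>y t. P y t = A t + integral {lo t..y} (\<lambda>\<eta>. p \<eta> t)"
    and A_cont: "continuous_on {0..T} A"
    and A_deriv: "\<And>t. t \<in> {0<..T} \<Longrightarrow>
          (A has_real_derivative p (lo t) t * lo' t + q (lo t) t) (at t within {0..T})"
    and lo_deriv: "\<And>t. t \<in> {0<..T} \<Longrightarrow> (lo has_real_derivative lo' t) (at t within {0..T})"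
    and lo'_cont: "continuous_on {0<..T} lo'"
    and p_pos: "\<And>y t. (y, t) \<in> region \<Longrightarrow> 0 < p y t"
    and p_y: "\<And>y t. (y, t) \<in> interior_pts \<Longrightarrow>
          ((\<lambda>\<eta>. p \<eta> t) has_real_derivative p_y y t) (at y within {lo t..hi t})"
    and p_y_cont: "continuous_on interior_pts (\<lambda>(y, t). p_y y t)"
begin

lemma potential_along_curve:
  assumes t0: "t0 \<in> {0<..T}"
    and \<gamma>: "\<And>t. t \<in> {0<..T} \<Longrightarrow> (\<gamma> has_real_derivative \<gamma>' t) (at t within {0..T})"
      "continuous_on {0<..T} \<gamma>'"
    and e: "0 < e"
    and ord: "\<And>t. t \<in> {0<..T} \<Longrightarrow> \<bar>t - t0\<bar> \<le> e \<Longrightarrow> lo t < \<gamma> t \<and> \<gamma> t \<le> hi t"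
  shows "((\<lambda>t. P (\<gamma> t) t) has_real_derivative p (\<gamma> t0) t0 * \<gamma>' t0 + q (\<gamma> t0) t0) (at t0 within {0..T})"
  unfolding P_def
  by (rule DERIV_cong[OF DERIV_add[OF A_deriv[OF t0] flux[OF t0 lo_deriv lo'_cont \<gamma> e]]])
    (use ord in auto)

sublocale coordinate_change lo hi T P p q p_y
proof
  have "continuous_on region (\<lambda>w. A (snd w))"
    by (rule continuous_on_compose2[OF A_cont]) (auto intro!: continuous_intros simp: closed_region_def)
  from continuous_on_add[OF this continuous_on_integral_from_lo[OF p_cont]]
  show "continuous_on region (\<lambda>(y, t). P y t)" by (simp add: P_def case_prod_unfold)
  show "P y t < P y' t" if t: "t \<in> {0..T}" and y: "lo t \<le> y" "y < y'" "y' \<le> hi t" for t y y'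
  proof -
    have c: "continuous_on {y..y'} (\<lambda>\<eta>. p \<eta> t)"
      by (rule continuous_on_subset[OF continuous_on_p_slice[OF t]]) (use y in auto)
    have "0 < integral {y..y'} (\<lambda>\<eta>. p \<eta> t)"
    proof -
      obtain y1 where y1: "y1 \<in> {y..y'}" "\<And>\<eta>. \<eta> \<in> {y..y'} \<Longrightarrow> p y1 t \<le> p \<eta> t"
        using continuous_attains_inf[OF compact_Icc _ c] y by auto
      have "0 < p y1 t" using p_pos[of y1 t] y1(1) y t by (auto simp: closed_region_def)
      then have "0 < (y' - y) * p y1 t" using y by simp
      also have "(y' - y) * p y1 t = integral {y..y'} (\<lambda>\<eta>. p y1 t)" using y by simp
      also have "\<dots> \<le> integral {y..y'} (\<lambda>\<eta>. p \<eta> t)"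
        using y1(2) c by (intro integral_le integrable_continuous_interval) auto
      finally show ?thesis .
    qed
    then show ?thesis using integral_between[OF t, of y y'] y by (simp add: P_def)
  qed
  show "((\<lambda>\<eta>. P \<eta> t) has_real_derivative p y t) (at y within {lo t..hi t})" if "(y, t) \<in> lateral" for y t
  proof -
    have "t \<in> {0..T}" "y \<in> {lo t..hi t}" using that by (auto simp: lateral_region_def)
    from DERIV_add[OF DERIV_const integral_has_real_derivative[OF continuous_on_p_slice this(2)]] this(1)
    show ?thesis by (simp add: P_def)
  qed
  show "(P y has_real_derivative q y t) (at t within {0..T})" if "(y, t) \<in> interior_pts" for y t
  proof -
    obtain e where e: "0 < e" "e < t" and
      rect: "\<And>y' \<tau>. \<bar>y' - y\<bar> \<le> e \<Longrightarrow> \<bar>\<tau> - t\<bar> \<le> e \<Longrightarrow> \<tau> \<le> T \<Longrightarrow> (y', \<tau>) \<in> interior_pts"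
      using inner_rectangle[OF \<open>(y, t) \<in> interior_pts\<close>] by blast
    have "t \<in> {0<..T}" using that by (auto simp: inner_region_def)
    then have "((\<lambda>t. P y t) has_real_derivative p y t * 0 + q y t) (at t within {0..T})"
    proof (rule potential_along_curve[OF _ DERIV_const continuous_on_const e(1)])
      fix \<tau> assume "\<tau> \<in> {0<..T}" "\<bar>\<tau> - t\<bar> \<le> e"
      then show "lo \<tau> < y \<and> y \<le> hi \<tau>" using rect[of y \<tau>] e(1) by (auto simp: inner_region_def)
    qed
    then show ?thesis by simp
  qed
  show "0 < p y t" if "(y, t) \<in> lateral" for y t using p_pos lateral_subset that by blast
  show "continuous_on lateral (\<lambda>(y, t). p y t)" by (rule continuous_on_subset[OF p_cont lateral_subset])
  show "continuous_on interior_pts (\<lambda>(y, t). q y t)" by (rule continuous_on_subset[OF q_cont inner_subset])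
qed (fact p_y p_y_cont)+

end

section \<open>Integrability of the boundary flux near the initial time\<close>

text \<open>
  The boundary flux \<open>q(0,t)\<close> may be unbounded as \<open>t \<rightarrow> 0\<close>. By the flux formula,
  \<open>d/dt \<integral>\<^sub>0\<^sup>y p d\<eta> = q(y,t) - q(0,t)\<close> for \<open>t > 0\<close>. Averaging over \<open>0 \<le> y \<le> a\<close> yields
  \<open>a q(0,t) = B(t) - d/dt \<integral>\<^sub>0\<^sup>a \<integral>\<^sub>0\<^sup>y p d\<eta> dy\<close> with \<open>B(t) = \<integral>\<^sub>0\<^sup>a q dy\<close>, and a primitive of the right-hand
  side is continuous up to \<open>t = 0\<close> as soon as \<open>B\<close> is.
\<close>

lemma (in closed_form) boundary_flux_primitive:
  assumes lo0: "lo = (\<lambda>_. 0)" and a: "0 < a" "\<And>t. t \<in> {0..T} \<Longrightarrow> a \<le> hi t"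
    and B: "continuous_on {0..T} B" "\<And>t. t \<in> {0<..T} \<Longrightarrow> ((\<lambda>y. q y t) has_integral B t) {0..a}"
  obtains Q where "continuous_on {0..T} Q"
    "\<And>t. t \<in> {0<..T} \<Longrightarrow> (Q has_real_derivative q 0 t) (at t within {0..T})"
proof -
  define F where "F t y = integral {0..y} (\<lambda>\<eta>. p \<eta> t)" for t y
  define Q where "Q t = (integral {0..t} B - integral {0..a} (F t)) / a" for t
  have F: "continuous_on ({0..T} \<times> {0..a}) (\<lambda>(t, y). F t y)"
  proof -
    have "continuous_on region (\<lambda>(y, t). F t y)"
      using continuous_on_integral_from_lo[OF p_cont] by (simp add: F_def lo0)
    moreover have "prod.swap ` ({0..T} \<times> {0..a}) \<subseteq> region"
      using a(2) by (force simp: closed_region_def lo0)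
    ultimately have "continuous_on ({0..T} \<times> {0..a}) (\<lambda>w. (\<lambda>(y, t). F t y) (prod.swap w))"
      by (intro continuous_on_compose2[OF _ continuous_on_swap])
    then show ?thesis by (simp add: case_prod_unfold)
  qed
  have "continuous_on {0..T} Q"
  proof -
    have "continuous_on {0..T} (\<lambda>t. integral {0..t} B)"
      by (intro indefinite_integral_continuous_1 integrable_continuous_interval B)
    moreover have "continuous_on {0..T} (\<lambda>t. integral {0..a} (F t))"
      using integral_continuous_on_param[of "{0..T}" 0 a F] F by simp
    ultimately show ?thesis unfolding Q_def using a(1) by (intro continuous_intros) auto
  qed
  moreover have "(Q has_real_derivative q 0 t0) (at t0 within {0..T})" if t0: "t0 \<in> {0<..T}" for t0
  proof -
    let ?U = "{t0 / 2..T}"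
    have U: "t \<in> {0<..T}" if "t \<in> ?U" for t using that t0 by auto
    have F_t: "((\<lambda>t. F t y) has_real_derivative q y t - q 0 t) (at t within {0..T})"
      if t: "t \<in> {0<..T}" and y: "y \<in> {0..a}" for t y
    proof (cases "y = 0")
      case True then show ?thesis by (simp add: F_def)
    next
      case False
      have "((\<lambda>t. integral {0..y} (\<lambda>\<eta>. p \<eta> t)) has_real_derivative
          (p y t * 0 + q y t) - (p 0 t * 0 + q 0 t)) (at t within {0..T})"
      proof (rule flux[OF t DERIV_const continuous_on_const DERIV_const continuous_on_const zero_less_one])
        fix \<tau> assume "\<tau> \<in> {0<..T}"
        then show "lo \<tau> \<le> 0 \<and> 0 < y \<and> y \<le> hi \<tau>" using a(2)[of \<tau>] y False by (simp add: lo0)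
      qed
      then show ?thesis by (simp add: F_def)
    qed
    have "((\<lambda>t. integral (cbox 0 a) (F t)) has_real_derivative
        integral (cbox 0 a) (\<lambda>y. q y t0 - q 0 t0)) (at t0 within ?U)"
    proof (rule leibniz_rule_field_derivative)
      show "((\<lambda>t. F t y) has_real_derivative q y t - q 0 t) (at t within ?U)"
        if "t \<in> ?U" "y \<in> cbox 0 a" for t y
        by (rule DERIV_subset[OF F_t]) (use that t0 in auto)
      show "F t integrable_on cbox 0 a" if "t \<in> ?U" for t
      proof (rule integrable_continuous)
        have "continuous_on (cbox 0 a) (\<lambda>y. (\<lambda>(t, y). F t y) (t, y))"
          by (rule continuous_on_compose2[OF F]) (use U[OF that] in \<open>auto intro!: continuous_intros\<close>)
        then show "continuous_on (cbox 0 a) (F t)" by simp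
      qed
      have q1: "continuous_on (?U \<times> cbox 0 a) (\<lambda>w. (\<lambda>(y, t). q y t) (k w, fst w))"
        if "continuous_on (?U \<times> cbox 0 a) k" "\<And>w. w \<in> ?U \<times> cbox 0 a \<Longrightarrow> k w \<in> {0..a}" for k
      proof (rule continuous_on_compose2[OF q_cont])
        show "(\<lambda>w. (k w, fst w)) ` (?U \<times> cbox 0 a) \<subseteq> lateral"
        proof (rule image_subsetI)
          fix w assume w: "w \<in> ?U \<times> cbox 0 a"
          then have "fst w \<in> {0<..T}" using U[of "fst w"] by (simp add: mem_Times_iff)
          then show "(k w, fst w) \<in> lateral"
            using that(2)[OF w] a(2)[of "fst w"] by (simp add: lateral_region_def lo0)
        qed
      qed (intro continuous_intros that)
      have "continuous_on (?U \<times> cbox 0 a) (\<lambda>w. (\<lambda>(y, t). q y t) (snd w, fst w) - (\<lambda>(y, t). q y t) (0, fst w))"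
        using a(1) by (intro continuous_on_diff q1 continuous_intros) auto
      then show "continuous_on (?U \<times> cbox 0 a) (\<lambda>(t, y). q y t - q 0 t)"
        by (simp add: case_prod_unfold)
    qed (use t0 in auto)
    moreover have "integral {0..a} (\<lambda>y. q y t0 - q 0 t0) = B t0 - a * q 0 t0"
      using has_integral_diff[OF B(2)[OF t0] has_integral_const_real[of "q 0 t0" 0 a]] a(1)
      by (simp add: integral_unique)
    moreover have "at t0 within ?U = at t0 within {0..T}"
      by (rule at_within_nhd[of _ "{t0 / 2<..}"]) (use t0 in auto)
    ultimately have D1: "((\<lambda>t. integral {0..a} (F t)) has_real_derivative B t0 - a * q 0 t0) (at t0 within {0..T})"
      by simp
    have D2: "((\<lambda>t. integral {0..t} B) has_real_derivative B t0) (at t0 within {0..T})"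
      by (rule integral_has_real_derivative[OF B(1)]) (use t0 in auto)
    show ?thesis
      unfolding Q_def by (rule DERIV_cong[OF DERIV_cdivide[OF DERIV_diff[OF D2 D1]]]) (use a(1) in simp)
  qed
  ultimately show ?thesis by (rule that)
qed

section \<open>The initial data\<close>

locale initial_data =
  fixes u\<^sub>0 :: "real \<Rightarrow> real" and b C\<^sub>1 :: real
  assumes b_pos: "0 < b" and u0_cont: "continuous_on {0..b} u\<^sub>0"
    and u0_pos: "\<And>x. x \<in> {0..b} \<Longrightarrow> 0 < u\<^sub>0 x"
begin

abbreviation "g \<equiv> initial_map u\<^sub>0 C\<^sub>1"
abbreviation "v\<^sub>0 \<equiv> burgers_initial u\<^sub>0 b C\<^sub>1"
abbreviation "C\<^sub>2 \<equiv> C\<^sub>1 + integral {0..b} (\<lambda>\<eta>. 1 / u\<^sub>0 \<eta>)"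

lemma g_deriv: 
  assumes "x \<in> {0..b}"
  shows "(g has_real_derivative 1 / u\<^sub>0 x) (at x within {0..b})"
proof -
  have "continuous_on {0..b} (\<lambda>\<eta>. 1 / u\<^sub>0 \<eta>)"
    using u0_pos by (intro continuous_on_divide continuous_on_const u0_cont) force
  from DERIV_add[OF DERIV_const integral_has_real_derivative[OF this assms]]
  show ?thesis by (simp add: initial_map_def[abs_def])
qed

lemma g_strict_mono: "0 \<le> x \<Longrightarrow> x < y \<Longrightarrow> y \<le> b \<Longrightarrow> g x < g y"
proof -
  assume xy: "0 \<le> x" "x < y" "y \<le> b"
  have "\<exists>l z. x < z \<and> z < y \<and> DERIV g z :> l \<and> g y - g x = (y - x) * l"
  proof (rule MVT[OF xy(2)])
    show "continuous_on {x..y} g"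
      by (rule continuous_on_subset[OF DERIV_continuous_on[OF g_deriv]]) (use xy in auto)
    show "g differentiable (at z)" if "x < z" "z < y" for z
      using g_deriv[of z] at_within_Icc_at[of 0 z b] that xy
      by (auto intro: has_real_derivative_imp_differentiable)
  qed
  then obtain l z where z: "x < z" "z < y" "DERIV g z :> l" "g y - g x = (y - x) * l" by blast
  have "DERIV g z :> 1 / u\<^sub>0 z"
    using g_deriv[of z] at_within_Icc_at[of 0 z b] z xy by auto
  then have "l = 1 / u\<^sub>0 z" using DERIV_unique z(3) by blast
  then have "0 < (y - x) * l" using u0_pos[of z] z xy by simp
  then show "g x < g y" using z(4) by linarith
qed

lemma g_0: "g 0 = C\<^sub>1" and g_b: "g b = C\<^sub>2"
  by (simp_all add: initial_map_def)

lemma inj_on_g: "inj_on g {0..b}"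
proof (rule linorder_inj_onI')
  fix x y assume "x \<in> {0..b}" "y \<in> {0..b}" "x < y"
  then show "g x \<noteq> g y" using g_strict_mono[of x y] by simp
qed

lemma v0_g: "x \<in> {0..b} \<Longrightarrow> v\<^sub>0 (g x) = u\<^sub>0 x"
  by (simp only: burgers_initial_def inv_into_f_f[OF inj_on_g])

lemma g_cont: "continuous_on {0..b} g"
  by (rule DERIV_continuous_on[OF g_deriv])

lemma g_image: "g ` {0..b} = {C\<^sub>1..C\<^sub>2}"
proof (intro subset_antisym subsetI)
  fix z assume "z \<in> {C\<^sub>1..C\<^sub>2}"
  then obtain x where "0 \<le> x" "x \<le> b" "g x = z"
    using IVT'[of g 0 z b] g_0 g_b b_pos g_cont by auto
  then show "z \<in> g ` {0..b}" by auto
next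
  fix z assume "z \<in> g ` {0..b}"
  then obtain x where x: "0 \<le> x" "x \<le> b" "z = g x" by auto
  have "g 0 \<le> g x" using g_strict_mono[of 0 x] x by (cases "x = 0") simp_all
  moreover have "g x \<le> g b" using g_strict_mono[of x b] x by (cases "x = b") simp_all
  ultimately show "z \<in> {C\<^sub>1..C\<^sub>2}" using x g_0 g_b by simp
qed

text \<open>
  The potential of \<open>v\<close> at the initial time inverts \<open>g\<close>: substituting \<open>z = g(y)\<close>, where
  \<open>g' = 1/u\<^sub>0\<close> and \<open>v\<^sub>0(g(y)) = u\<^sub>0(y)\<close>, turns the integrand into \<open>1\<close>.
\<close>

lemma integral_v0: 
  assumes x: "x \<in> {0..b}"
  shows "integral {C\<^sub>1..g x} v\<^sub>0 = x"
proof -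
  have "continuous_on (g ` {0..b}) (inv_into {0..b} g)"
    by (rule continuous_on_inv[OF g_cont compact_Icc]) (simp add: inv_into_f_f[OF inj_on_g])
  then have "continuous_on {C\<^sub>1..C\<^sub>2} (inv_into {0..b} g)" unfolding g_image .
  moreover have "inv_into {0..b} g ` {C\<^sub>1..C\<^sub>2} \<subseteq> {0..b}"
    unfolding g_image[symmetric] by (auto simp: inv_into_f_f[OF inj_on_g])
  ultimately have v0: "continuous_on {C\<^sub>1..C\<^sub>2} v\<^sub>0"
    unfolding burgers_initial_def by (intro continuous_on_compose2[OF u0_cont])
  have "((\<lambda>y. (1 / u\<^sub>0 y) *\<^sub>R v\<^sub>0 (g y)) has_integral integral {g 0..g x} v\<^sub>0) {0..x}"
  proof (rule has_integral_substitution[OF _ _ _ v0])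
    show "g 0 \<le> g x" using g_strict_mono[of 0 x] x by (cases "x = 0") simp_all
    have "g ` {0..x} \<subseteq> g ` {0..b}" using x by (intro image_mono) simp
    then show "g ` {0..x} \<subseteq> {C\<^sub>1..C\<^sub>2}" unfolding g_image .
    show "(g has_real_derivative 1 / u\<^sub>0 y) (at y within {0..x})" if "y \<in> {0..x}" for y
      by (rule DERIV_subset[OF g_deriv]) (use that x in auto)
  qed (use x in auto)
  moreover have "((\<lambda>y. (1 / u\<^sub>0 y) *\<^sub>R v\<^sub>0 (g y)) has_integral x) {0..x}"
  proof (rule has_integral_eq)
    show "((\<lambda>_. 1) has_integral x) {0..x}" using has_integral_const_real[of "1::real" 0 x] x by simp
    show "1 = (1 / u\<^sub>0 y) *\<^sub>R v\<^sub>0 (g y)" if "y \<in> {0..x}" for y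
      using v0_g[of y] u0_pos[of y] that x by simp
  qed
  ultimately show ?thesis using has_integral_unique g_0 by metis
qed

end

section \<open>The two directions of the transformation\<close>

lemma continuous_at_lateral_side:
  fixes h :: "real \<Rightarrow> real"
  assumes "continuous_on {0<..T} h" "t \<in> {0<..T}"
  shows "continuous (at t within {0..T}) h"
proof -
  have "at t within {0..T} = at t within {0<..T}"
    by (rule at_within_nhd[of _ "{0<..}"]) (use assms in auto)
  then show ?thesis using assms by (simp add: continuous_on_eq_continuous_within)
qed

text \<open>
  The form is \<open>(1/u) dx + (u - D u\<^sub>x) dt\<close>. The integral equation for \<open>z\<^sub>0\<close> is the definition of \<open>z\<close>
  rewritten with \<open>v\<^sub>z = u\<^sub>x u\<close>; the one for \<open>z\<^sub>1\<close> follows from \<open>z\<^sub>1' = (1 + 1/\<beta>) s'\<close> and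
  \<open>s' = \<beta> - D u\<^sub>x = \<beta> - D v\<^sub>z / \<beta>\<close> on the free boundary.
\<close>

lemma fbp_imp_burgers:
  fixes D \<beta> b \<sigma> C\<^sub>1 :: real and f u\<^sub>0 s :: "real \<Rightarrow> real" and u :: "real \<Rightarrow> real \<Rightarrow> real"
  assumes D: "0 < D" and \<beta>: "0 < \<beta>" and b: "0 < b" and \<sigma>: "0 < \<sigma>"
    and u0_cont: "continuous_on {0..b} u\<^sub>0" and u0_ge: "\<And>x. x \<in> {0..b} \<Longrightarrow> \<beta> \<le> u\<^sub>0 x"
    and f_ge: "\<And>t. t \<in> {0..\<sigma>} \<Longrightarrow> \<beta> \<le> f t"
    and sol: "fbp_solution D \<beta> b \<sigma> f u\<^sub>0 u s"
  defines "Z \<equiv> to_z D u s C\<^sub>1"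
  defines "v \<equiv> change_var (\<lambda>_. 0) s Z u"
  defines "z\<^sub>0 \<equiv> \<lambda>t. Z 0 t"
  defines "z\<^sub>1 \<equiv> \<lambda>t. Z (s t) t"
  defines "C\<^sub>2 \<equiv> C\<^sub>1 + integral {0..b} (\<lambda>\<eta>. 1 / u\<^sub>0 \<eta>)"
  shows "\<forall>t\<in>{0..\<sigma>}. \<forall>x\<in>{0..s t}. v (Z x t) t = u x t"
    and "left_boundary_eq D \<sigma> f C\<^sub>1 v z\<^sub>0 z\<^sub>1"
    and "right_boundary_eq D \<beta> \<sigma> C\<^sub>2 v z\<^sub>0 z\<^sub>1"
    and "burgers_solution D \<beta> \<sigma> f C\<^sub>1 C\<^sub>2 (burgers_initial u\<^sub>0 b C\<^sub>1) v z\<^sub>0 z\<^sub>1"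
proof -
  define u\<^sub>x where "u\<^sub>x = space_deriv (\<lambda>_. 0) s u"
  define u\<^sub>x\<^sub>x where "u\<^sub>x\<^sub>x = space_deriv (\<lambda>_. 0) s u\<^sub>x"
  note sol' = sol[unfolded fbp_solution_def Let_def, folded u\<^sub>x_def, folded u\<^sub>x\<^sub>x_def]
  have s: "continuous_on {0..\<sigma>} s" "\<And>t. t \<in> {0<..\<sigma>} \<Longrightarrow> s differentiable (at t within {0..\<sigma>})"
      "continuous_on {0<..\<sigma>} (time_deriv \<sigma> s)"
    and s_pos: "\<And>t. t \<in> {0..\<sigma>} \<Longrightarrow> 0 < s t"
    and cl: "classical (\<lambda>_. 0) s \<sigma> u"
    and init: "\<And>x. x \<in> {0..b} \<Longrightarrow> u x 0 = u\<^sub>0 x" and s0: "s 0 = b"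
    using sol' by (auto simp: free_boundary_def)
  have pde: "time_deriv \<sigma> (u x) t = (u x t)\<^sup>2 * (D * u\<^sub>x\<^sub>x x t - u\<^sub>x x t)"
    if "t \<in> {0<..\<sigma>}" "0 < x" "x < s t" for x t
    using sol' that by simp
  have bc: "u 0 t = f t" "u (s t) t = \<beta>" "D * u\<^sub>x (s t) t - u (s t) t = - time_deriv \<sigma> s t"
    if "t \<in> {0<..\<sigma>}" for t
    using sol' that by blast+
  interpret reg: moving_region "\<lambda>_. 0" s \<sigma>
    by unfold_locales (use \<sigma> s(1) s_pos in auto)
  interpret ini: initial_data u\<^sub>0 b C\<^sub>1
    by unfold_locales (use b u0_cont u0_ge \<beta> in force)+
  have ge: "\<beta> \<le> u x t" if "(x, t) \<in> reg.region" for x t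
  proof (rule reg.minimum_principle[OF cl _ _ _ that])
    show "\<beta> \<le> u y 0" if "y \<in> {0..s 0}" for y using that init u0_ge s0 by simp
    show "\<beta> \<le> u 0 t \<and> \<beta> \<le> u (s t) t" if "t \<in> {0<..\<sigma>}" for t
      using bc[OF that] f_ge[of t] that by simp
    show "0 \<le> time_deriv \<sigma> (u y) t"
      if "(y, t) \<in> reg.interior_pts" "space_deriv (\<lambda>_. 0) s u y t = 0"
        "0 \<le> space_deriv (\<lambda>_. 0) s (space_deriv (\<lambda>_. 0) s u) y t" for y t
      using that pde[of t y] D by (simp add: inner_region_def u\<^sub>x_def u\<^sub>x\<^sub>x_def)
  qed
  have pos: "0 < u x t" if "(x, t) \<in> reg.region" for x t using ge[OF that] \<beta> by simp
  have ne_lat: "u x t \<noteq> 0" if "(x, t) \<in> reg.lateral" for x t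
    using pos[of x t] that reg.lateral_subset by auto
  have ne_int: "u x t \<noteq> 0" if "(x, t) \<in> reg.interior_pts" for x t
    using ne_lat[of x t] that reg.inner_subset by auto
  have inter: "t \<in> {0<..\<sigma>}" "0 < x" "x < s t" if "(x, t) \<in> reg.interior_pts" for x t
    using that by (auto simp: inner_region_def)
  have u_cont: "continuous_on reg.region (\<lambda>w. u (fst w) (snd w))"
    using classical_cont[OF cl] by (simp only: case_prod_unfold)
  have ux_cont: "continuous_on reg.lateral (\<lambda>w. u\<^sub>x (fst w) (snd w))"
    using classical_space_cont[OF cl] by (simp only: case_prod_unfold u\<^sub>x_def)
  have ut_cont: "continuous_on reg.interior_pts (\<lambda>w. time_deriv \<sigma> (u (fst w)) (snd w))"
    using classical_time_cont[OF cl] by (simp only: case_prod_unfold)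
  note u_lat = continuous_on_subset[OF u_cont reg.lateral_subset]
  note u_int = continuous_on_subset[OF u_lat reg.inner_subset]
  note ux_int = continuous_on_subset[OF ux_cont reg.inner_subset]
  define p where "p x t = 1 / u x t" for x t
  define q where "q x t = u x t - D * u\<^sub>x x t" for x t
  define p_t where "p_t x t = - time_deriv \<sigma> (u x) t / (u x t)\<^sup>2" for x t
  define p_x where "p_x x t = - u\<^sub>x x t / (u x t)\<^sup>2" for x t
  interpret cf: closed_form "\<lambda>_. 0" s \<sigma> p q p_t
  proof unfold_locales
    show "continuous_on reg.region (\<lambda>(y, t). p y t)"
      unfolding p_def case_prod_unfold
      by (intro continuous_on_divide continuous_on_const u_cont) (use pos in force)
    show "continuous_on reg.lateral (\<lambda>(y, t). q y t)"
      unfolding q_def case_prod_unfold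
      by (intro continuous_on_diff continuous_on_mult continuous_on_const u_lat ux_cont)
    show "continuous_on reg.interior_pts (\<lambda>(y, t). p_t y t)"
      unfolding p_t_def case_prod_unfold
      by (intro continuous_on_divide continuous_on_minus continuous_on_power u_int ut_cont)
        (use ne_int in force)
    fix x t assume xt: "(x, t) \<in> reg.interior_pts"
    have lat: "(x, t) \<in> reg.lateral" using xt reg.inner_subset by blast
    show "((\<lambda>\<tau>. p x \<tau>) has_real_derivative p_t x t) (at t within {0..\<sigma>})"
      unfolding p_def p_t_def
      by (rule DERIV_cong[OF DERIV_divide[OF DERIV_const classical_time_deriv[OF cl xt]]])
        (use ne_int[OF xt] in \<open>simp_all add: power2_eq_square\<close>)
    have "p_t x t = u\<^sub>x x t - D * u\<^sub>x\<^sub>x x t"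
      using pde[OF inter[OF xt]] ne_int[OF xt] by (simp add: p_t_def)
    moreover have "((\<lambda>\<eta>. q \<eta> t) has_real_derivative u\<^sub>x x t - D * u\<^sub>x\<^sub>x x t) (at x within {0..s t})"
      using DERIV_diff[OF classical_space_deriv[OF cl lat] DERIV_cmult[OF classical_space_deriv2[OF cl xt]]]
      by (simp add: q_def u\<^sub>x_def u\<^sub>x\<^sub>x_def)
    ultimately show "((\<lambda>\<eta>. q \<eta> t) has_real_derivative p_t x t) (at x within {0..s t})" by simp
  qed
  \<comment> \<open>As \<open>s\<close> has a positive minimum \<open>a\<close>, the flux may be averaged over \<open>[0,a]\<close> at all times. The
    average \<open>B\<close> involves only values of \<open>u\<close>.\<close>
  obtain a where a: "0 < a" "\<And>t. t \<in> {0..\<sigma>} \<Longrightarrow> a \<le> s t"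
  proof -
    have "{0..\<sigma>} \<noteq> {}" using \<sigma> by simp
    then obtain t1 where "t1 \<in> {0..\<sigma>}" "\<And>t. t \<in> {0..\<sigma>} \<Longrightarrow> s t1 \<le> s t"
      using continuous_attains_inf[OF compact_Icc _ s(1)] by blast
    then show ?thesis using that[of "s t1"] s_pos[of t1] by simp
  qed
  define B where "B t = integral {0..a} (\<lambda>x. u x t) - D * (u a t - u 0 t)" for t
  have "continuous_on {0..\<sigma>} B"
  proof -
    have u1: "continuous_on {0..\<sigma>} (\<lambda>t. u y t)" if y: "y \<in> {0..a}" for y
    proof -
      have "continuous_on {0..\<sigma>} (\<lambda>t. (\<lambda>(x, t). u x t) (y, t))"
      proof (rule continuous_on_compose2[OF classical_cont[OF cl]])
        show "Pair y ` {0..\<sigma>} \<subseteq> reg.region"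
          using a(2) y by (force simp: closed_region_def)
      qed (intro continuous_intros)
      then show ?thesis by simp
    qed
    have "continuous_on ({0..\<sigma>} \<times> cbox 0 a) (\<lambda>w. (\<lambda>(x, t). u x t) (prod.swap w))"
    proof (rule continuous_on_compose2[OF classical_cont[OF cl] continuous_on_swap])
      show "prod.swap ` ({0..\<sigma>} \<times> cbox 0 a) \<subseteq> reg.region"
        using a(2) by (force simp: closed_region_def)
    qed
    then have "continuous_on ({0..\<sigma>} \<times> cbox 0 a) (\<lambda>(t, x). u x t)"
      by (simp add: case_prod_unfold)
    from integral_continuous_on_param[OF this]
    have "continuous_on {0..\<sigma>} (\<lambda>t. integral {0..a} (\<lambda>x. u x t))" by simp
    then show ?thesis
      unfolding B_def using a(1) by (intro continuous_on_diff continuous_on_mult continuous_on_const u1) auto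
  qed
  moreover have "((\<lambda>x. q x t) has_integral B t) {0..a}" if t: "t \<in> {0<..\<sigma>}" for t
  proof -
    have sub: "{0..a} \<subseteq> {0..s t}" using a(2)[of t] t by simp
    have "continuous_on {0..a} (\<lambda>x. u x t)"
      by (rule continuous_on_slice[OF classical_cont[OF cl]])
        (use sub t in \<open>force simp: closed_region_def\<close>)
    then have "((\<lambda>x. u x t) has_integral integral {0..a} (\<lambda>x. u x t)) {0..a}"
      by (intro integrable_integral integrable_continuous_interval)
    moreover have "((\<lambda>x. u\<^sub>x x t) has_integral u a t - u 0 t) {0..a}"
    proof (rule fundamental_theorem_of_calculus)
      fix x assume "x \<in> {0..a}"
      then have "(x, t) \<in> reg.lateral" using sub t by (auto simp: lateral_region_def)
      from DERIV_subset[OF classical_space_deriv[OF cl this] sub]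
      show "((\<lambda>x. u x t) has_vector_derivative u\<^sub>x x t) (at x within {0..a})"
        by (simp add: u\<^sub>x_def has_real_derivative_iff_has_vector_derivative)
    qed (use a in simp)
    ultimately show ?thesis
      unfolding q_def B_def by (intro has_integral_diff has_integral_mult_right)
  qed
  ultimately obtain Q where Q: "continuous_on {0..\<sigma>} Q"
    "\<And>t. t \<in> {0<..\<sigma>} \<Longrightarrow> (Q has_real_derivative q 0 t) (at t within {0..\<sigma>})"
    using cf.boundary_flux_primitive[OF refl a] by blast
  have left_int: "((\<lambda>\<tau>. u 0 \<tau> - D * space_deriv (\<lambda>_. 0) s u 0 \<tau>) has_integral Q t - Q 0) {0..t}"
    if t: "t \<in> {0..\<sigma>}" for t
  proof (rule fundamental_theorem_of_calculus_interior)
    show "continuous_on {0..t} Q" by (rule continuous_on_subset[OF Q(1)]) (use t in auto)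
    fix \<tau> assume \<tau>: "\<tau> \<in> {0<..<t}"
    then have "(Q has_real_derivative q 0 \<tau>) (at \<tau>)"
      using Q(2)[of \<tau>] t at_within_Icc_at[of 0 \<tau> \<sigma>] by simp
    then show "(Q has_vector_derivative u 0 \<tau> - D * space_deriv (\<lambda>_. 0) s u 0 \<tau>) (at \<tau>)"
      by (simp add: q_def u\<^sub>x_def has_real_derivative_iff_has_vector_derivative)
  qed (use t in auto)
  define A where "A t = C\<^sub>1 + integral {0..t} (\<lambda>\<tau>. u 0 \<tau> - D * space_deriv (\<lambda>_. 0) s u 0 \<tau>)" for t
  have A_eq: "A t = C\<^sub>1 + (Q t - Q 0)" if "t \<in> {0..\<sigma>}" for t
    using left_int[OF that] by (simp add: A_def integral_unique)
  interpret pot: potential "\<lambda>_. 0" s \<sigma> p q p_t Z p_x A "\<lambda>_. 0"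
  proof unfold_locales
    show "Z y t = A t + integral {0..y} (\<lambda>\<eta>. p \<eta> t)" for y t
      by (simp add: Z_def to_z_def A_def p_def)
    have "continuous_on {0..\<sigma>} (\<lambda>t. C\<^sub>1 + (Q t - Q 0))" by (intro continuous_intros Q(1))
    then show "continuous_on {0..\<sigma>} A" by (rule continuous_on_eq) (simp add: A_eq)
    show "(A has_real_derivative p 0 t * 0 + q 0 t) (at t within {0..\<sigma>})" if t: "t \<in> {0<..\<sigma>}" for t
    proof -
      have "((\<lambda>t. C\<^sub>1 + (Q t - Q 0)) has_real_derivative 0 + (q 0 t - 0)) (at t within {0..\<sigma>})"
        by (intro DERIV_add DERIV_diff DERIV_const Q(2)[OF t])
      then have "(A has_real_derivative 0 + (q 0 t - 0)) (at t within {0..\<sigma>})"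
        by (rule has_field_derivative_transform_within[OF _ zero_less_one]) (use t in \<open>simp_all add: A_eq\<close>)
      then show ?thesis by simp
    qed
    show "0 < p y t" if "(y, t) \<in> reg.region" for y t using pos[OF that] by (simp add: p_def)
    show "((\<lambda>\<eta>. p \<eta> t) has_real_derivative p_x y t) (at y within {0..s t})"
      if "(y, t) \<in> reg.interior_pts" for y t
    proof -
      have "(y, t) \<in> reg.lateral" using that reg.inner_subset by blast
      from DERIV_divide[OF DERIV_const classical_space_deriv[OF cl this] ne_int[OF that], of 1]
      show ?thesis by (simp add: p_def p_x_def u\<^sub>x_def power2_eq_square)
    qed
    show "continuous_on reg.interior_pts (\<lambda>(y, t). p_x y t)"
      unfolding p_x_def case_prod_unfold
      by (intro continuous_on_divide continuous_on_minus continuous_on_power u_int ux_int)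
        (use ne_int in force)
  qed (simp_all add: DERIV_const)
  have v_Z: "v (Z x t) t = u x t" if "t \<in> {0..\<sigma>}" "0 \<le> x" "x \<le> s t" for x t
    unfolding v_def by (rule pot.W_P[OF cl that])
  have v_z: "space_deriv z\<^sub>0 z\<^sub>1 v (Z x t) t = u\<^sub>x x t * u x t"
    if t: "t \<in> {0<..\<sigma>}" and x: "0 \<le> x" "x \<le> s t" for x t
  proof -
    have t': "t \<in> {0..\<sigma>}" using t by simp
    have "(Z x t, t) \<in> pot.image.lateral"
      using pot.P_range[OF t' x] t by (simp add: lateral_region_def)
    from pot.space_deriv_W[OF cl this] pot.X_P[OF t' x]
    show ?thesis by (simp add: v_def z\<^sub>0_def z\<^sub>1_def u\<^sub>x_def p_def)
  qed
  have z1_deriv: "(z\<^sub>1 has_real_derivative (1 + 1 / \<beta>) * time_deriv \<sigma> s t) (at t within {0..\<sigma>})"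
    if t: "t \<in> {0<..\<sigma>}" for t
  proof -
    have "((\<lambda>t. Z (s t) t) has_real_derivative p (s t) t * time_deriv \<sigma> s t + q (s t) t) (at t within {0..\<sigma>})"
      by (rule pot.potential_along_curve[OF t has_real_derivative_time_deriv[OF s(2)] s(3) zero_less_one])
        (use s_pos in auto)
    moreover have "p (s t) t * time_deriv \<sigma> s t + q (s t) t = (1 + 1 / \<beta>) * time_deriv \<sigma> s t"
      using bc[OF t] by (simp add: p_def q_def algebra_simps)
    ultimately show ?thesis by (simp add: z\<^sub>1_def)
  qed
  have z1_time: "time_deriv \<sigma> z\<^sub>1 t = (1 + 1 / \<beta>) * time_deriv \<sigma> s t" if t: "t \<in> {0<..\<sigma>}" for t
    by (rule time_deriv_eqI[OF z1_deriv[OF t] \<sigma>]) (use t in auto)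
  have z0_cont: "continuous_on {0..\<sigma>} z\<^sub>0" and z1_cont: "continuous_on {0..\<sigma>} z\<^sub>1"
    unfolding z\<^sub>0_def z\<^sub>1_def by (rule pot.image.lo_cont, rule pot.image.hi_cont)
  have Z_0: "Z x 0 = ini.g x" if x: "x \<in> {0..b}" for x
  proof -
    have "integral {0..x} (\<lambda>\<eta>. 1 / u \<eta> 0) = integral {0..x} (\<lambda>\<eta>. 1 / u\<^sub>0 \<eta>)"
      by (rule integral_cong) (use init x in auto)
    then show ?thesis by (simp add: Z_def to_z_def initial_map_def)
  qed
  have z00: "z\<^sub>0 0 = C\<^sub>1" using Z_0[of 0] ini.g_0 b by (simp add: z\<^sub>0_def)
  have z10: "z\<^sub>1 0 = C\<^sub>2" using Z_0[of b] ini.g_b b by (simp add: z\<^sub>1_def s0 C\<^sub>2_def)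
  show "\<forall>t\<in>{0..\<sigma>}. \<forall>x\<in>{0..s t}. v (Z x t) t = u x t" using v_Z by simp
  show "left_boundary_eq D \<sigma> f C\<^sub>1 v z\<^sub>0 z\<^sub>1"
    unfolding left_boundary_eq_def
  proof
    fix t assume t: "t \<in> {0..\<sigma>}"
    have "((\<lambda>\<tau>. f \<tau> - D * (space_deriv z\<^sub>0 z\<^sub>1 v (z\<^sub>0 \<tau>) \<tau> / f \<tau>)) has_integral Q t - Q 0) {0..t}"
    proof (rule has_integral_spike_finite[OF _ _ left_int[OF t], of "{0}"])
      fix \<tau> assume "\<tau> \<in> {0..t} - {0}"
      then have \<tau>: "\<tau> \<in> {0<..\<sigma>}" using t by auto
      then have "0 < s \<tau>" "\<tau> \<in> {0..\<sigma>}" using s_pos[of \<tau>] by auto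
      then have "space_deriv z\<^sub>0 z\<^sub>1 v (z\<^sub>0 \<tau>) \<tau> = u\<^sub>x 0 \<tau> * f \<tau>"
        using v_z[OF \<tau>, of 0] bc(1)[OF \<tau>] by (simp add: z\<^sub>0_def)
      moreover have "f \<tau> \<noteq> 0" using f_ge[OF \<open>\<tau> \<in> {0..\<sigma>}\<close>] \<beta> by simp
      ultimately show "f \<tau> - D * (space_deriv z\<^sub>0 z\<^sub>1 v (z\<^sub>0 \<tau>) \<tau> / f \<tau>) =
          u 0 \<tau> - D * space_deriv (\<lambda>_. 0) s u 0 \<tau>"
        using bc(1)[OF \<tau>] by (simp add: u\<^sub>x_def)
    qed simp
    moreover have "z\<^sub>0 t = C\<^sub>1 + (Q t - Q 0)"
      using A_eq[OF t] by (simp add: z\<^sub>0_def pot.P_def)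
    ultimately show "(\<lambda>\<tau>. f \<tau> - D * (space_deriv z\<^sub>0 z\<^sub>1 v (z\<^sub>0 \<tau>) \<tau> / f \<tau>)) integrable_on {0..t} \<and>
        z\<^sub>0 t = C\<^sub>1 + integral {0..t} (\<lambda>\<tau>. f \<tau> - D * (space_deriv z\<^sub>0 z\<^sub>1 v (z\<^sub>0 \<tau>) \<tau> / f \<tau>))"
      by (auto simp: integral_unique)
  qed
  show "right_boundary_eq D \<beta> \<sigma> C\<^sub>2 v z\<^sub>0 z\<^sub>1"
    unfolding right_boundary_eq_def
  proof
    fix t assume t: "t \<in> {0..\<sigma>}"
    \<comment> \<open>The integral equation solved for the integral of \<open>v\<^sub>z(z\<^sub>1(\<tau>),\<tau>)\<close>, up to a constant.\<close>
    define R where "R t = (\<beta> / D) * ((\<beta> + \<beta>\<^sup>2) * t - \<beta> * z\<^sub>1 t) / (\<beta> + 1)" for t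
    have "((\<lambda>\<tau>. space_deriv z\<^sub>0 z\<^sub>1 v (z\<^sub>1 \<tau>) \<tau>) has_integral R t - R 0) {0..t}"
    proof (rule fundamental_theorem_of_calculus_interior)
      show "continuous_on {0..t} R"
        unfolding R_def using \<beta> D t
        by (intro continuous_intros continuous_on_subset[OF z1_cont]) auto
      fix \<tau> assume \<tau>': "\<tau> \<in> {0<..<t}"
      then have \<tau>: "\<tau> \<in> {0<..\<sigma>}" "\<tau> < \<sigma>" using t by auto
      have "(z\<^sub>1 has_real_derivative (1 + 1 / \<beta>) * time_deriv \<sigma> s \<tau>) (at \<tau>)"
        using z1_deriv[OF \<tau>(1)] \<tau> at_within_Icc_at[of 0 \<tau> \<sigma>] by simp
      then have "(R has_real_derivative
          (\<beta> / D) * ((\<beta> + \<beta>\<^sup>2) * 1 - \<beta> * ((1 + 1 / \<beta>) * time_deriv \<sigma> s \<tau>)) / (\<beta> + 1)) (at \<tau>)"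
        unfolding R_def by (intro DERIV_cdivide DERIV_cmult DERIV_diff DERIV_ident)
      moreover have "(\<beta> / D) * ((\<beta> + \<beta>\<^sup>2) * 1 - \<beta> * ((1 + 1 / \<beta>) * time_deriv \<sigma> s \<tau>)) / (\<beta> + 1) =
          space_deriv z\<^sub>0 z\<^sub>1 v (z\<^sub>1 \<tau>) \<tau>"
      proof -
        have "0 \<le> s \<tau>" using s_pos[of \<tau>] \<tau> by simp
        then have *: "space_deriv z\<^sub>0 z\<^sub>1 v (z\<^sub>1 \<tau>) \<tau> = u\<^sub>x (s \<tau>) \<tau> * \<beta>"
          using v_z[OF \<tau>(1), of "s \<tau>"] bc(2)[OF \<tau>(1)] by (simp add: z\<^sub>1_def)
        have **: "time_deriv \<sigma> s \<tau> = \<beta> - D * u\<^sub>x (s \<tau>) \<tau>" using bc(2,3)[OF \<tau>(1)] by simp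
        have "(\<beta> + \<beta>\<^sup>2) * 1 - \<beta> * ((1 + 1 / \<beta>) * time_deriv \<sigma> s \<tau>) = (\<beta> + 1) * (D * u\<^sub>x (s \<tau>) \<tau>)"
          unfolding ** using \<beta> by (simp add: field_simps power2_eq_square)
        then show ?thesis unfolding * using \<beta> D by simp
      qed
      ultimately show "(R has_vector_derivative space_deriv z\<^sub>0 z\<^sub>1 v (z\<^sub>1 \<tau>) \<tau>) (at \<tau>)"
        by (simp add: has_real_derivative_iff_has_vector_derivative)
    qed (use t in auto)
    moreover have "z\<^sub>1 t = C\<^sub>2 + (\<beta> + 1) * t - D * (\<beta> + 1) / \<beta>\<^sup>2 * (R t - R 0)"
    proof -
      have "R t - R 0 = \<beta>\<^sup>2 / (D * (\<beta> + 1)) * ((1 + \<beta>) * t - (z\<^sub>1 t - C\<^sub>2))"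
        using \<beta> D by (simp add: R_def z10 divide_simps) (simp add: algebra_simps power2_eq_square)
      then have "D * (\<beta> + 1) / \<beta>\<^sup>2 * (R t - R 0) = (1 + \<beta>) * t - (z\<^sub>1 t - C\<^sub>2)"
        using \<beta> D by simp
      then show ?thesis by (simp add: algebra_simps)
    qed
    ultimately show "(\<lambda>\<tau>. space_deriv z\<^sub>0 z\<^sub>1 v (z\<^sub>1 \<tau>) \<tau>) integrable_on {0..t} \<and>
        z\<^sub>1 t = C\<^sub>2 + (\<beta> + 1) * t
          - D * (\<beta> + 1) / \<beta>\<^sup>2 * integral {0..t} (\<lambda>\<tau>. space_deriv z\<^sub>0 z\<^sub>1 v (z\<^sub>1 \<tau>) \<tau>)"
      by (auto simp: integral_unique)
  qed
  show "burgers_solution D \<beta> \<sigma> f C\<^sub>1 C\<^sub>2 (burgers_initial u\<^sub>0 b C\<^sub>1) v z\<^sub>0 z\<^sub>1"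
    unfolding burgers_solution_def Let_def
  proof (intro conjI ballI)
    show "free_boundary \<sigma> z\<^sub>1"
      unfolding free_boundary_def
    proof (intro conjI ballI z1_cont)
      show "z\<^sub>1 differentiable (at t within {0..\<sigma>})" if "t \<in> {0<..\<sigma>}" for t
        by (rule has_real_derivative_imp_differentiable[OF z1_deriv[OF that]])
      have "continuous_on {0<..\<sigma>} (\<lambda>t. (1 + 1 / \<beta>) * time_deriv \<sigma> s t)"
        by (intro continuous_on_mult continuous_on_const s(3))
      then show "continuous_on {0<..\<sigma>} (time_deriv \<sigma> z\<^sub>1)"
        by (rule continuous_on_eq) (simp add: z1_time)
    qed
    show "z\<^sub>0 t < z\<^sub>1 t" if "t \<in> {0..\<sigma>}" for t
      unfolding z\<^sub>0_def z\<^sub>1_def by (rule pot.image.lo_less_hi[OF that])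
    show "classical z\<^sub>0 z\<^sub>1 \<sigma> v"
      unfolding z\<^sub>0_def z\<^sub>1_def v_def by (rule pot.classical_W[OF cl])
    show "time_deriv \<sigma> (v z) t = D * space_deriv z\<^sub>0 z\<^sub>1 (space_deriv z\<^sub>0 z\<^sub>1 v) z t -
        2 * v z t * space_deriv z\<^sub>0 z\<^sub>1 v z t"
      if t: "t \<in> {0<..\<sigma>}" and z: "z \<in> {z\<^sub>0 t<..<z\<^sub>1 t}" for t z
    proof -
      have zt: "(z, t) \<in> pot.image.interior_pts"
        using t z by (simp add: inner_region_def z\<^sub>0_def z\<^sub>1_def)
      then have zt': "(z, t) \<in> pot.image.lateral" using pot.image.inner_subset by blast
      define x where "x = pot.X z t"
      have xt: "(x, t) \<in> reg.interior_pts" unfolding x_def by (rule pot.X_interior[OF zt])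
      have algebra: "ux * (- (U - D * ux) / (1 / U)) + U\<^sup>2 * (D * uxx - ux) =
          D * ((uxx * (1 / U) - ux * (- ux / U\<^sup>2)) / (1 / U) ^ 3) - 2 * U * (ux / (1 / U))"
        if "U \<noteq> 0" for U ux uxx :: real
        using that by (simp add: field_simps power2_eq_square power3_eq_cube)
      have "v z t = u x t" by (simp add: v_def change_var_def x_def)
      then show ?thesis
        using algebra[OF ne_int[OF xt], of "u\<^sub>x x t" "u\<^sub>x\<^sub>x x t"]
          pot.time_deriv_W[OF cl zt] pot.space_deriv_W[OF cl zt'] pot.space_deriv2_W[OF cl zt]
          pde[OF inter[OF xt]]
        by (simp only: v_def[symmetric] z\<^sub>0_def[symmetric] z\<^sub>1_def[symmetric] x_def[symmetric]
            u\<^sub>x_def[symmetric] u\<^sub>x\<^sub>x_def[symmetric] p_def q_def p_x_def)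
    qed
    fix t assume t: "t \<in> {0<..\<sigma>}"
    then have t': "t \<in> {0..\<sigma>}" by simp
    have st: "0 \<le> s t" using s_pos[OF t'] by simp
    show "v (z\<^sub>0 t) t = f t" using v_Z[OF t', of 0] st bc(1)[OF t] by (simp add: z\<^sub>0_def)
    show v1: "v (z\<^sub>1 t) t = \<beta>" using v_Z[OF t', of "s t"] st bc(2)[OF t] by (simp add: z\<^sub>1_def)
    have "space_deriv z\<^sub>0 z\<^sub>1 v (z\<^sub>1 t) t = u\<^sub>x (s t) t * \<beta>"
      using v_z[OF t, of "s t"] st bc(2)[OF t] by (simp add: z\<^sub>1_def)
    moreover have "- (\<beta> / (\<beta> + 1)) * time_deriv \<sigma> z\<^sub>1 t = - time_deriv \<sigma> s t"
      using \<beta> z1_time[OF t] by (simp add: field_simps)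
    ultimately show "D * (space_deriv z\<^sub>0 z\<^sub>1 v (z\<^sub>1 t) t / v (z\<^sub>1 t) t) - v (z\<^sub>1 t) t =
        - (\<beta> / (\<beta> + 1)) * time_deriv \<sigma> z\<^sub>1 t"
      using bc(2,3)[OF t] v1 \<beta> by simp
  next
    fix z assume "z \<in> {C\<^sub>1..C\<^sub>2}"
    then obtain x where x: "x \<in> {0..b}" "z = ini.g x"
      using ini.g_image unfolding C\<^sub>2_def by blast
    have "v (Z x 0) 0 = u x 0" using v_Z[of 0 x] x \<sigma> s0 by simp
    then show "v z 0 = ini.v\<^sub>0 z" using x init ini.v0_g Z_0 by simp
  qed (fact z0_cont z00 z10)+
qed

text \<open>
  The form is \<open>v dz + (D v\<^sub>z - v\<^sup>2) dt\<close>, and \<open>s\<close> is the value of its potential on the right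
  boundary.
\<close>

lemma burgers_imp_fbp:
  fixes D \<beta> b \<sigma> C\<^sub>1 :: real and f u\<^sub>0 z\<^sub>0 z\<^sub>1 :: "real \<Rightarrow> real" and v :: "real \<Rightarrow> real \<Rightarrow> real"
  assumes D: "0 < D" and \<beta>: "0 < \<beta>" and b: "0 < b" and \<sigma>: "0 < \<sigma>"
    and u0_cont: "continuous_on {0..b} u\<^sub>0" and u0_ge: "\<And>x. x \<in> {0..b} \<Longrightarrow> \<beta> \<le> u\<^sub>0 x"
    and f_cont: "continuous_on {0..\<sigma>} f" and f_ge: "\<And>t. t \<in> {0..\<sigma>} \<Longrightarrow> \<beta> \<le> f t"
  defines "C\<^sub>2 \<equiv> C\<^sub>1 + integral {0..b} (\<lambda>\<eta>. 1 / u\<^sub>0 \<eta>)"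
  assumes sol: "burgers_solution D \<beta> \<sigma> f C\<^sub>1 C\<^sub>2 (burgers_initial u\<^sub>0 b C\<^sub>1) v z\<^sub>0 z\<^sub>1"
    and left: "left_boundary_eq D \<sigma> f C\<^sub>1 v z\<^sub>0 z\<^sub>1"
  defines "X \<equiv> to_x v z\<^sub>0"
  defines "u \<equiv> change_var z\<^sub>0 z\<^sub>1 X v"
  defines "s \<equiv> \<lambda>t. X (z\<^sub>1 t) t"
  shows "\<forall>t\<in>{0..\<sigma>}. \<forall>z\<in>{z\<^sub>0 t..z\<^sub>1 t}. u (X z t) t = v z t"
    and "fbp_solution D \<beta> b \<sigma> f u\<^sub>0 u s"
proof -
  define v\<^sub>z where "v\<^sub>z = space_deriv z\<^sub>0 z\<^sub>1 v"
  define v\<^sub>z\<^sub>z where "v\<^sub>z\<^sub>z = space_deriv z\<^sub>0 z\<^sub>1 v\<^sub>z"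
  note sol' = sol[unfolded burgers_solution_def Let_def, folded v\<^sub>z_def, folded v\<^sub>z\<^sub>z_def]
  have z0_cont: "continuous_on {0..\<sigma>} z\<^sub>0"
    and z1: "continuous_on {0..\<sigma>} z\<^sub>1" "\<And>t. t \<in> {0<..\<sigma>} \<Longrightarrow> z\<^sub>1 differentiable (at t within {0..\<sigma>})"
      "continuous_on {0<..\<sigma>} (time_deriv \<sigma> z\<^sub>1)"
    and less: "\<And>t. t \<in> {0..\<sigma>} \<Longrightarrow> z\<^sub>0 t < z\<^sub>1 t"
    and cl: "classical z\<^sub>0 z\<^sub>1 \<sigma> v"
    and init: "\<And>z. z \<in> {C\<^sub>1..C\<^sub>2} \<Longrightarrow> v z 0 = burgers_initial u\<^sub>0 b C\<^sub>1 z"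
    and ends: "z\<^sub>0 0 = C\<^sub>1" "z\<^sub>1 0 = C\<^sub>2"
    using sol' by (auto simp: free_boundary_def)
  have pde: "time_deriv \<sigma> (v z) t = D * v\<^sub>z\<^sub>z z t - 2 * v z t * v\<^sub>z z t"
    if "t \<in> {0<..\<sigma>}" "z\<^sub>0 t < z" "z < z\<^sub>1 t" for z t
    using sol' that by simp
  have bc: "v (z\<^sub>0 t) t = f t" "v (z\<^sub>1 t) t = \<beta>"
    "D * (v\<^sub>z (z\<^sub>1 t) t / v (z\<^sub>1 t) t) - v (z\<^sub>1 t) t = - (\<beta> / (\<beta> + 1)) * time_deriv \<sigma> z\<^sub>1 t"
    if "t \<in> {0<..\<sigma>}" for t
    using sol' that by blast+
  interpret reg: moving_region z\<^sub>0 z\<^sub>1 \<sigma>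
    by unfold_locales (fact \<sigma> z0_cont z1(1) less)+
  interpret ini: initial_data u\<^sub>0 b C\<^sub>1
    by unfold_locales (use b u0_cont u0_ge \<beta> in force)+
  have init_g: "v (ini.g x) 0 = u\<^sub>0 x" if "x \<in> {0..b}" for x
  proof -
    have "ini.g x \<in> {C\<^sub>1..C\<^sub>2}" using ini.g_image that unfolding C\<^sub>2_def by blast
    then show ?thesis using init ini.v0_g[OF that] by simp
  qed
  have ge: "\<beta> \<le> v z t" if "(z, t) \<in> reg.region" for z t
  proof (rule reg.minimum_principle[OF cl _ _ _ that])
    fix z assume "z \<in> {z\<^sub>0 0..z\<^sub>1 0}"
    then have "z \<in> ini.g ` {0..b}" unfolding ini.g_image ends C\<^sub>2_def .
    then obtain x where "x \<in> {0..b}" "z = ini.g x" by blast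
    then show "\<beta> \<le> v z 0" using init_g u0_ge by simp
  next
    show "\<beta> \<le> v (z\<^sub>0 t) t \<and> \<beta> \<le> v (z\<^sub>1 t) t" if "t \<in> {0<..\<sigma>}" for t
      using bc[OF that] f_ge[of t] that by simp
    show "0 \<le> time_deriv \<sigma> (v z) t"
      if "(z, t) \<in> reg.interior_pts" "space_deriv z\<^sub>0 z\<^sub>1 v z t = 0"
        "0 \<le> space_deriv z\<^sub>0 z\<^sub>1 (space_deriv z\<^sub>0 z\<^sub>1 v) z t" for z t
      using that pde[of t z] D by (simp add: inner_region_def v\<^sub>z_def v\<^sub>z\<^sub>z_def)
  qed
  have pos: "0 < v z t" if "(z, t) \<in> reg.region" for z t using ge[OF that] \<beta> by simp
  have inter: "t \<in> {0<..\<sigma>}" "z\<^sub>0 t < z" "z < z\<^sub>1 t" if "(z, t) \<in> reg.interior_pts" for z t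
    using that by (auto simp: inner_region_def)
  have vz_cont: "continuous_on reg.lateral (\<lambda>(z, t). v\<^sub>z z t)"
    using classical_space_cont[OF cl] by (simp only: v\<^sub>z_def)
  define q where "q z t = D * v\<^sub>z z t - (v z t)\<^sup>2" for z t
  interpret cf: closed_form z\<^sub>0 z\<^sub>1 \<sigma> v q "\<lambda>z. time_deriv \<sigma> (v z)"
  proof unfold_locales
    show "continuous_on reg.region (\<lambda>(y, t). v y t)" by (rule classical_cont[OF cl])
    show "continuous_on reg.lateral (\<lambda>(y, t). q y t)"
      using vz_cont continuous_on_subset[OF classical_cont[OF cl] reg.lateral_subset]
      unfolding q_def case_prod_unfold
      by (intro continuous_on_diff continuous_on_mult continuous_on_const continuous_on_power)
    show "continuous_on reg.interior_pts (\<lambda>(y, t). time_deriv \<sigma> (v y) t)"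
      by (rule classical_time_cont[OF cl])
    fix z t assume zt: "(z, t) \<in> reg.interior_pts"
    have lat: "(z, t) \<in> reg.lateral" using zt reg.inner_subset by blast
    show "((\<lambda>\<tau>. v z \<tau>) has_real_derivative time_deriv \<sigma> (v z) t) (at t within {0..\<sigma>})"
      by (rule classical_time_deriv[OF cl zt])
    have "((\<lambda>\<eta>. q \<eta> t) has_real_derivative D * v\<^sub>z\<^sub>z z t - 2 * v z t * v\<^sub>z z t) (at z within {z\<^sub>0 t..z\<^sub>1 t})"
      using DERIV_diff[OF DERIV_cmult[OF classical_space_deriv2[OF cl zt]]
          DERIV_power[OF classical_space_deriv[OF cl lat], of 2]]
      by (simp add: q_def v\<^sub>z_def v\<^sub>z\<^sub>z_def mult_ac)
    then show "((\<lambda>\<eta>. q \<eta> t) has_real_derivative time_deriv \<sigma> (v z) t) (at z within {z\<^sub>0 t..z\<^sub>1 t})"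
      using pde[OF inter[OF zt]] by simp
  qed
  \<comment> \<open>The integral equation makes \<open>z\<^sub>0\<close> a \<open>C\<^sup>1\<close> curve, along which the form vanishes.\<close>
  define z\<^sub>0' where "z\<^sub>0' \<tau> = f \<tau> - D * (v\<^sub>z (z\<^sub>0 \<tau>) \<tau> / f \<tau>)" for \<tau>
  have f_pos: "0 < f t" if "t \<in> {0..\<sigma>}" for t using f_ge[OF that] \<beta> by simp
  have z0'_cont: "continuous_on {0<..\<sigma>} z\<^sub>0'"
  proof -
    have "continuous_on {0<..\<sigma>} (\<lambda>t. (\<lambda>(z, t). v\<^sub>z z t) (z\<^sub>0 t, t))"
    proof (rule continuous_on_compose2[OF vz_cont])
      show "continuous_on {0<..\<sigma>} (\<lambda>t. (z\<^sub>0 t, t))"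
        by (intro continuous_intros continuous_on_subset[OF z0_cont]) auto
      show "(\<lambda>t. (z\<^sub>0 t, t)) ` {0<..\<sigma>} \<subseteq> reg.lateral"
      proof (rule image_subsetI)
        fix t assume "t \<in> {0<..\<sigma>}"
        then show "(z\<^sub>0 t, t) \<in> reg.lateral" using less[of t] by (simp add: lateral_region_def)
      qed
    qed
    then have "continuous_on {0<..\<sigma>} (\<lambda>t. v\<^sub>z (z\<^sub>0 t) t)" by simp
    moreover have "continuous_on {0<..\<sigma>} f" by (rule continuous_on_subset[OF f_cont]) auto
    moreover have "\<forall>t\<in>{0<..\<sigma>}. f t \<noteq> 0"
    proof
      fix t assume "t \<in> {0<..\<sigma>}"
      then show "f t \<noteq> 0" using f_pos[of t] by simp
    qed
    ultimately show ?thesis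
      unfolding z\<^sub>0'_def
      by (intro continuous_on_diff continuous_on_mult continuous_on_const continuous_on_divide)
  qed
  have z0_eq: "z\<^sub>0' integrable_on {0..t}" "z\<^sub>0 t = C\<^sub>1 + integral {0..t} z\<^sub>0'" if "t \<in> {0..\<sigma>}" for t
    using left that unfolding left_boundary_eq_def z\<^sub>0'_def[abs_def] v\<^sub>z_def by blast+
  have z0_deriv: "(z\<^sub>0 has_real_derivative z\<^sub>0' t) (at t within {0..\<sigma>})" if t: "t \<in> {0<..\<sigma>}" for t
  proof -
    have "((\<lambda>t. integral {0..t} z\<^sub>0') has_vector_derivative z\<^sub>0' t) (at t within {0..\<sigma>} - {})"
      by (rule integral_has_vector_derivative_continuous_at)
        (use z0_eq(1)[of \<sigma>] \<sigma> t continuous_at_lateral_side[OF z0'_cont t] in auto)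
    then have "((\<lambda>t. C\<^sub>1 + integral {0..t} z\<^sub>0') has_real_derivative 0 + z\<^sub>0' t) (at t within {0..\<sigma>})"
      by (intro DERIV_add DERIV_const) (simp add: has_real_derivative_iff_has_vector_derivative)
    then have "(z\<^sub>0 has_real_derivative 0 + z\<^sub>0' t) (at t within {0..\<sigma>})"
      by (rule has_field_derivative_transform_within[OF _ zero_less_one]) (use t z0_eq(2) in auto)
    then show ?thesis by simp
  qed
  interpret pot: potential z\<^sub>0 z\<^sub>1 \<sigma> v q "\<lambda>z. time_deriv \<sigma> (v z)" X v\<^sub>z "\<lambda>_. 0" z\<^sub>0'
  proof unfold_locales
    show "X z t = 0 + integral {z\<^sub>0 t..z} (\<lambda>\<eta>. v \<eta> t)" for z t by (simp add: X_def to_x_def)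
    show "((\<lambda>_. 0) has_real_derivative v (z\<^sub>0 t) t * z\<^sub>0' t + q (z\<^sub>0 t) t) (at t within {0..\<sigma>})"
      if t: "t \<in> {0<..\<sigma>}" for t
    proof -
      have "f t \<noteq> 0" using f_pos[of t] t by simp
      then have "v (z\<^sub>0 t) t * z\<^sub>0' t + q (z\<^sub>0 t) t = 0"
        by (simp add: bc(1)[OF t] z\<^sub>0'_def q_def field_simps power2_eq_square)
      then show ?thesis by simp
    qed
    show "(z\<^sub>0 has_real_derivative z\<^sub>0' t) (at t within {0..\<sigma>})" if "t \<in> {0<..\<sigma>}" for t
      by (rule z0_deriv[OF that])
    show "continuous_on {0<..\<sigma>} z\<^sub>0'" by (rule z0'_cont)
    show "0 < v y t" if "(y, t) \<in> reg.region" for y t by (rule pos[OF that])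
    show "((\<lambda>\<eta>. v \<eta> t) has_real_derivative v\<^sub>z y t) (at y within {z\<^sub>0 t..z\<^sub>1 t})"
      if "(y, t) \<in> reg.interior_pts" for y t
    proof -
      have "(y, t) \<in> reg.lateral" using that reg.inner_subset by blast
      then show ?thesis unfolding v\<^sub>z_def by (rule classical_space_deriv[OF cl])
    qed
    show "continuous_on reg.interior_pts (\<lambda>(y, t). v\<^sub>z y t)"
      by (rule continuous_on_subset[OF vz_cont reg.inner_subset])
  qed simp
  have X_left: "(\<lambda>t. X (z\<^sub>0 t) t) = (\<lambda>_. 0)" by (simp add: X_def to_x_def)
  have s_eq: "s = pot.HI" by (simp add: s_def)
  have u_X: "u (X z t) t = v z t" if "t \<in> {0..\<sigma>}" "z\<^sub>0 t \<le> z" "z \<le> z\<^sub>1 t" for z t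
    unfolding u_def by (rule pot.W_P[OF cl that])
  have s_deriv: "(s has_real_derivative \<beta> / (\<beta> + 1) * time_deriv \<sigma> z\<^sub>1 t) (at t within {0..\<sigma>})"
    if t: "t \<in> {0<..\<sigma>}" for t
  proof -
    have "((\<lambda>t. X (z\<^sub>1 t) t) has_real_derivative v (z\<^sub>1 t) t * time_deriv \<sigma> z\<^sub>1 t + q (z\<^sub>1 t) t)
        (at t within {0..\<sigma>})"
      by (rule pot.potential_along_curve[OF t has_real_derivative_time_deriv[OF z1(2)] z1(3) zero_less_one])
        (use less in auto)
    moreover have "v (z\<^sub>1 t) t * time_deriv \<sigma> z\<^sub>1 t + q (z\<^sub>1 t) t = \<beta> / (\<beta> + 1) * time_deriv \<sigma> z\<^sub>1 t"
    proof -
      have "D * v\<^sub>z (z\<^sub>1 t) t = \<beta> * (\<beta> - \<beta> / (\<beta> + 1) * time_deriv \<sigma> z\<^sub>1 t)"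
        using bc(2,3)[OF t] \<beta> by (simp add: field_simps)
      then show ?thesis
        using \<beta> by (simp add: bc(2)[OF t] q_def divide_simps) (simp add: algebra_simps power2_eq_square)
    qed
    ultimately show ?thesis by (simp add: s_def)
  qed
  have s_time: "time_deriv \<sigma> s t = \<beta> / (\<beta> + 1) * time_deriv \<sigma> z\<^sub>1 t" if t: "t \<in> {0<..\<sigma>}" for t
    by (rule time_deriv_eqI[OF s_deriv[OF t] \<sigma>]) (use t in auto)
  have X_0: "X (ini.g x) 0 = x" if x: "x \<in> {0..b}" for x
  proof -
    have "ini.g x \<in> {C\<^sub>1..C\<^sub>2}" using ini.g_image x unfolding C\<^sub>2_def by blast
    then have "integral {C\<^sub>1..ini.g x} (\<lambda>\<eta>. v \<eta> 0) = integral {C\<^sub>1..ini.g x} ini.v\<^sub>0"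
      by (intro integral_cong init) auto
    then show ?thesis using ini.integral_v0[OF x] by (simp add: X_def to_x_def ends)
  qed
  show "\<forall>t\<in>{0..\<sigma>}. \<forall>z\<in>{z\<^sub>0 t..z\<^sub>1 t}. u (X z t) t = v z t" using u_X by simp
  show "fbp_solution D \<beta> b \<sigma> f u\<^sub>0 u s"
    unfolding fbp_solution_def Let_def
  proof (intro conjI ballI)
    show "free_boundary \<sigma> s"
      unfolding free_boundary_def
    proof (intro conjI ballI)
      show "continuous_on {0..\<sigma>} s" unfolding s_eq by (rule pot.image.hi_cont)
      show "s differentiable (at t within {0..\<sigma>})" if "t \<in> {0<..\<sigma>}" for t
        by (rule has_real_derivative_imp_differentiable[OF s_deriv[OF that]])
      have "continuous_on {0<..\<sigma>} (\<lambda>t. \<beta> / (\<beta> + 1) * time_deriv \<sigma> z\<^sub>1 t)"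
        by (intro continuous_on_mult continuous_on_const z1(3))
      then show "continuous_on {0<..\<sigma>} (time_deriv \<sigma> s)"
        by (rule continuous_on_eq) (simp add: s_time)
    qed
    show "0 < s t" if "t \<in> {0..\<sigma>}" for t
      using pot.image.lo_less_hi[OF that] by (simp add: s_def X_def to_x_def)
    show "classical (\<lambda>_. 0) s \<sigma> u"
      using pot.classical_W[OF cl] unfolding X_left u_def s_def .
    show "time_deriv \<sigma> (u x) t = (u x t)\<^sup>2 *
        (D * space_deriv (\<lambda>_. 0) s (space_deriv (\<lambda>_. 0) s u) x t - space_deriv (\<lambda>_. 0) s u x t)"
      if t: "t \<in> {0<..\<sigma>}" and x: "x \<in> {0<..<s t}" for t x
    proof -
      have xt: "(x, t) \<in> pot.image.interior_pts"
        unfolding X_left using t x by (simp add: inner_region_def s_def)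
      then have xt': "(x, t) \<in> pot.image.lateral" using pot.image.inner_subset by blast
      define z where "z = pot.X x t"
      have zt: "(z, t) \<in> reg.interior_pts" unfolding z_def by (rule pot.X_interior[OF xt])
      have "v z t \<noteq> 0" using pos[of z t] zt reg.inner_subset reg.lateral_subset by auto
      have algebra: "vz * (- (D * vz - V\<^sup>2) / V) + (D * vzz - 2 * V * vz) =
          V\<^sup>2 * (D * ((vzz * V - vz * vz) / V ^ 3) - vz / V)" if "V \<noteq> 0" for V vz vzz :: real
        using that by (simp add: field_simps power2_eq_square power3_eq_cube)
      have "u x t = v z t" by (simp add: u_def change_var_def z_def)
      then show ?thesis
        using algebra[OF \<open>v z t \<noteq> 0\<close>, of "v\<^sub>z z t" "v\<^sub>z\<^sub>z z t"]
          pot.time_deriv_W[OF cl xt] pot.space_deriv_W[OF cl xt'] pot.space_deriv2_W[OF cl xt]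
          pde[OF inter[OF zt]]
        by (simp only: X_left u_def[symmetric] s_def[symmetric] z_def[symmetric]
            v\<^sub>z_def[symmetric] v\<^sub>z\<^sub>z_def[symmetric] q_def)
    qed
    fix t assume t: "t \<in> {0<..\<sigma>}"
    then have t': "t \<in> {0..\<sigma>}" by simp
    show "u 0 t = f t"
      using u_X[OF t', of "z\<^sub>0 t"] less[OF t'] bc(1)[OF t] fun_cong[OF X_left, of t] by simp
    show u1: "u (s t) t = \<beta>"
      using u_X[OF t', of "z\<^sub>1 t"] less[OF t'] bc(2)[OF t] by (simp add: s_def)
    have "(s t, t) \<in> pot.image.lateral"
      using t pot.image.lo_less_hi[OF t'] by (simp add: lateral_region_def s_def)
    from pot.space_deriv_W[OF cl this] pot.X_P[OF t', of "z\<^sub>1 t"] less[OF t']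
    have "space_deriv (\<lambda>_. 0) s u (s t) t = v\<^sub>z (z\<^sub>1 t) t / v (z\<^sub>1 t) t"
      unfolding X_left by (simp add: u_def s_def v\<^sub>z_def)
    then show "D * space_deriv (\<lambda>_. 0) s u (s t) t - u (s t) t = - time_deriv \<sigma> s t"
      using bc(2,3)[OF t] u1 s_time[OF t] by simp
  next
    fix x assume x: "x \<in> {0..b}"
    have "ini.g x \<in> {C\<^sub>1..C\<^sub>2}" using ini.g_image x unfolding C\<^sub>2_def by blast
    then have "u (X (ini.g x) 0) 0 = v (ini.g x) 0" using u_X[of 0 "ini.g x"] \<sigma> ends by simp
    then show "u x 0 = u\<^sub>0 x" using X_0[OF x] init_g[OF x] by simp
  next
    have "X C\<^sub>2 0 = b" using X_0[of b] b ini.g_b by (simp add: C\<^sub>2_def)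
    then show "s 0 = b" by (simp add: s_def ends)
  qed
qed

theorem lemma2p1:
  fixes D \<beta> b \<sigma> :: real and f u\<^sub>0 :: "real \<Rightarrow> real"
  assumes "D > 0" "\<beta> > 0" "b > 0" "\<sigma> > 0"
    and "C1_on_interval 0 \<sigma> f" and "C1_on_interval 0 b u\<^sub>0"
    and "u\<^sub>0 0 = f 0" and "u\<^sub>0 b = \<beta>"
    and "\<forall>x\<in>{0..<b}. u\<^sub>0 x > \<beta>"
    and "\<forall>t\<in>{0..\<sigma>}. f t > 3 * \<beta> / 2"
  shows
    "(\<forall>u s C\<^sub>1. fbp_solution D \<beta> b \<sigma> f u\<^sub>0 u s \<longrightarrow>
        (let Z = to_z D u s C\<^sub>1;
             v = change_var (\<lambda>_. 0) s Z u;
             z\<^sub>0 = (\<lambda>t. Z 0 t);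
             z\<^sub>1 = (\<lambda>t. Z (s t) t);
             C\<^sub>2 = C\<^sub>1 + integral {0..b} (\<lambda>\<eta>. 1 / u\<^sub>0 \<eta>);
             v\<^sub>0 = burgers_initial u\<^sub>0 b C\<^sub>1
         in (\<forall>t\<in>{0..\<sigma>}. \<forall>x\<in>{0..s t}. v (Z x t) t = u x t) \<and>
            left_boundary_eq D \<sigma> f C\<^sub>1 v z\<^sub>0 z\<^sub>1 \<and>
            right_boundary_eq D \<beta> \<sigma> C\<^sub>2 v z\<^sub>0 z\<^sub>1 \<and>
            burgers_solution D \<beta> \<sigma> f C\<^sub>1 C\<^sub>2 v\<^sub>0 v z\<^sub>0 z\<^sub>1 \<and>
            b = integral {C\<^sub>1..C\<^sub>2} v\<^sub>0)) \<and>
     (\<forall>v z\<^sub>0 z\<^sub>1 C\<^sub>1.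
        (let C\<^sub>2 = C\<^sub>1 + integral {0..b} (\<lambda>\<eta>. 1 / u\<^sub>0 \<eta>);
             v\<^sub>0 = burgers_initial u\<^sub>0 b C\<^sub>1;
             X = to_x v z\<^sub>0;
             u = change_var z\<^sub>0 z\<^sub>1 X v;
             s = (\<lambda>t. X (z\<^sub>1 t) t)
         in burgers_solution D \<beta> \<sigma> f C\<^sub>1 C\<^sub>2 v\<^sub>0 v z\<^sub>0 z\<^sub>1 \<and>
            left_boundary_eq D \<sigma> f C\<^sub>1 v z\<^sub>0 z\<^sub>1 \<longrightarrow>
            (\<forall>t\<in>{0..\<sigma>}. \<forall>z\<in>{z\<^sub>0 t..z\<^sub>1 t}. u (X z t) t = v z t) \<and>
            fbp_solution D \<beta> b \<sigma> f u\<^sub>0 u s))"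
proof -
  have C1_cont: "continuous_on {x..y} h" if "C1_on_interval x y h" for x y h
    using that DERIV_continuous_on unfolding C1_on_interval_def by blast
  have u0_cont: "continuous_on {0..b} u\<^sub>0" and f_cont: "continuous_on {0..\<sigma>} f"
    using assms C1_cont by blast+
  have u0_ge: "\<beta> \<le> u\<^sub>0 x" if "x \<in> {0..b}" for x
    using assms that by (cases "x = b") (auto intro: less_imp_le)
  have f_ge: "\<beta> \<le> f t" if "t \<in> {0..\<sigma>}" for t
  proof -
    have "3 * \<beta> / 2 < f t" using assms that by blast
    then show ?thesis using \<open>\<beta> > 0\<close> by simp
  qed
  have total: "b = integral {C\<^sub>1..C\<^sub>1 + integral {0..b} (\<lambda>\<eta>. 1 / u\<^sub>0 \<eta>)} (burgers_initial u\<^sub>0 b C\<^sub>1)" for C\<^sub>1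
  proof -
    interpret initial_data u\<^sub>0 b C\<^sub>1
      by unfold_locales (use assms u0_cont u0_ge in force)+
    show ?thesis using integral_v0[of b] g_b \<open>b > 0\<close> by simp
  qed
  show ?thesis
    unfolding Let_def
    by (intro conjI allI impI total; (elim conjE)?;
        rule fbp_imp_burgers[OF assms(1-4) u0_cont u0_ge f_ge]
          burgers_imp_fbp[OF assms(1-4) u0_cont u0_ge f_cont f_ge];
        assumption)
qed

end
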